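(* Let $d\ge 1$, $n\ge 2$, let $X=\{x_1,\dots,x_n\}\subset\mathbb{R}^d$ be distinct points, $m\colon\mathbb{R}^d\to\mathbb{R}$ a function, $Y=(y_1,\dots,y_n)\in\mathbb{R}^n$ and $Y_m=(y_i-m(x_i))_{i=1}^n$. Let $K(x,y)=\Phi(x-y)$, $x,y\in\mathbb{R}^d$, be a positive-definite kernel, where $\Phi\colon\mathbb{R}^d\to\mathbb{R}$ is continuous and integrable and there are constants $C_1,C_2>0$ and $\alpha>d/2$ such that $C_1(1+\|\xi\|^2)^{-\alpha}\le\widehat\Phi(\xi)\le C_2(1+\|\xi\|^2)^{-\alpha}$ for all $\xi\in\mathbb{R}^d$. For $\lambda>0$ set $K_\lambda(x,y)=\Phi((x-y)/\lambda)$ and $$\ell(\lambda\mid Y)=Y_m^{\mathsf T}K_\lambda(X,X)^{-1}Y_m+\log\det K_\lambda(X,X),$$ and let $\lambda_{\mathrm{ML}}\in\arg\min_{\lambda>0}\ell(\lambda\mid Y)$. If $Y$ is $m$-constant, i.e. $Y_m=(c,\dots,c)$ for some $c\in\mathbb{R}$, then $$\lim_{\lambda\to\infty}\ell(\lambda\mid Y)=-\infty\quad\text{and}\quad\lambda_{\mathrm{ML}}=\infty.$$ If $Y$ is not $m$-constant, then $$\lim_{\lambda\to\infty}\ell(\lambda\mid Y)=\infty\quad\text{and}\quad\lambda_{\mathrm{ML}}<\infty.$$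
   Context: A kernel $K\colon\mathbb{R}^d\times\mathbb{R}^d\to\mathbb{R}$ is a symmetric function; it is (strictly) positive-definite if $\sum_{i,j}a_ia_jK(z_i,z_j)>0$ for all $N\in\mathbb{N}$, all non-zero $a\in\mathbb{R}^N$ and all distinct $z_1,\dots,z_N$. $K_\lambda(X,X)=(K_\lambda(x_i,x_j))_{i,j=1}^n$. The Fourier transform is $\widehat f(\xi)=\int_{\mathbb{R}^d}f(x)e^{-\mathrm{i}\xi^{\mathsf T}x}\,dx$. Convention on minimisers: $\lambda_{\mathrm{ML}}=\infty$ means that every sequence $(\lambda_k)$ in $(0,\infty)$ with $\ell(\lambda_k\mid Y)\to\inf_{\lambda>0}\ell(\lambda\mid Y)$ satisfies $\lambda_k\to\infty$; $\lambda_{\mathrm{ML}}<\infty$ means that every such sequence is bounded. *)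

theory Defs
  imports "HOL-Analysis.Analysis"
begin

text \<open>Strict positive definiteness: kernels are symmetric, the points are distinct, and the
  inequality is strict.\<close>

definition positive_definite_kernel :: "('a \<Rightarrow> 'a \<Rightarrow> real) \<Rightarrow> bool" where
  "positive_definite_kernel K \<longleftrightarrow>
     (\<forall>x y. K x y = K y x) \<and>
     (\<forall>(N::nat) (z :: nat \<Rightarrow> 'a) (a :: nat \<Rightarrow> real).
        inj_on z {..<N} \<longrightarrow> (\<exists>i<N. a i \<noteq> 0) \<longrightarrow>
        (\<Sum>i<N. \<Sum>j<N. a i * a j * K (z i) (z j)) > 0)"

definition fourier_transform :: "('a::euclidean_space \<Rightarrow> real) \<Rightarrow> 'a \<Rightarrow> complex" where
  "fourier_transform f \<xi> =
     (\<integral>x. complex_of_real (f x) * exp (- \<i> * complex_of_real (\<xi> \<bullet> x)) \<partial>lborel)"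

text \<open>For an even function (in particular when \<open>f (x - y)\<close> is symmetric in \<open>x\<close> and \<open>y\<close>) the
  Fourier transform is real, so inequalities may be stated for its real part.\<close>

lemma fourier_transform_even_real:
  fixes f :: "'a::euclidean_space \<Rightarrow> real"
  assumes "\<And>x. f (- x) = f x"
  shows "fourier_transform f \<xi> \<in> \<real>"
proof -
  let ?g = "\<lambda>x. complex_of_real (f x) * exp (- \<i> * complex_of_real (\<xi> \<bullet> x))"
  have eq: "lborel = distr lborel borel (\<lambda>x::'a. - x)"
  proof -
    have *: "(\<lambda>x::'a. (0::'a) + (-1) *\<^sub>R x) = (\<lambda>x. - x)" by auto
    have "(lborel :: 'a measure) =
        density (distr lborel borel (\<lambda>x. (0::'a) + (-1) *\<^sub>R x)) (\<lambda>_. (\<bar>-1::real\<bar> ^ DIM('a)))"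
      by (rule lborel_affine) simp
    then show ?thesis unfolding * by (simp add: density_1)
  qed
  have "integral\<^sup>L lborel (\<lambda>x. cnj (?g x)) = integral\<^sup>L lborel ?g"
  proof -
    have c: "cnj (?g x) = ?g (- x)" for x
      by (simp add: exp_cnj assms)
    have "integral\<^sup>L lborel (\<lambda>x. ?g (- x)) = integral\<^sup>L lborel ?g"
    proof (cases "?g \<in> borel_measurable borel")
      case True
      then have "integral\<^sup>L (distr lborel borel (\<lambda>x::'a. - x)) ?g = integral\<^sup>L lborel (\<lambda>x. ?g (- x))"
        by (intro integral_distr) auto
      then show ?thesis using eq by simp
    next
      case False
      have "\<not> integrable lborel ?g"
        using False by (auto dest: borel_measurable_integrable)
      moreover have "\<not> integrable lborel (\<lambda>x. ?g (- x))"
        using calculation unfolding c[symmetric] complex_integrable_cnj by simp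
      ultimately show ?thesis by (metis (no_types, lifting) not_integrable_integral_eq)
    qed
    then show ?thesis unfolding c .
  qed
  then show ?thesis
    unfolding fourier_transform_def Reals_cnj_iff by (metis Bochner_Integration.integral_cnj)
qed

definition scaled_kernel ::
  "('a::real_vector \<Rightarrow> real) \<Rightarrow> real \<Rightarrow> 'a \<Rightarrow> 'a \<Rightarrow> real" where
  "scaled_kernel \<Phi> lam x y = \<Phi> ((x - y) /\<^sub>R lam)"

definition kernel_matrix ::
  "('a \<Rightarrow> 'a \<Rightarrow> real) \<Rightarrow> ('n::finite \<Rightarrow> 'a) \<Rightarrow> real ^ 'n ^ 'n" where
  "kernel_matrix K x = (\<chi> i j. K (x i) (x j))"

definition centred ::
  "('a \<Rightarrow> real) \<Rightarrow> ('n::finite \<Rightarrow> 'a) \<Rightarrow> real ^ 'n \<Rightarrow> real ^ 'n" where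
  "centred m x Y = (\<chi> i. Y $ i - m (x i))"

definition m_constant ::
  "('a \<Rightarrow> real) \<Rightarrow> ('n::finite \<Rightarrow> 'a) \<Rightarrow> real ^ 'n \<Rightarrow> bool" where
  "m_constant m x Y \<longleftrightarrow> (\<exists>c::real. centred m x Y = (\<chi> i. c))"

definition likelihood_loss ::
  "('a::real_vector \<Rightarrow> real) \<Rightarrow> ('a \<Rightarrow> real) \<Rightarrow> ('n::finite \<Rightarrow> 'a) \<Rightarrow> real ^ 'n \<Rightarrow> real \<Rightarrow> real" where
  "likelihood_loss \<Phi> m x Y lam =
     centred m x Y \<bullet> (matrix_inv (kernel_matrix (scaled_kernel \<Phi> lam) x) *v centred m x Y)
     + ln (det (kernel_matrix (scaled_kernel \<Phi> lam) x))"

text \<open>The infimum over the positive half-line may be \<open>-\<infinity>\<close>, hence both it and the convergence to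
  it are taken in the extended reals.\<close>

definition minimising_sequence :: "(real \<Rightarrow> real) \<Rightarrow> (nat \<Rightarrow> real) \<Rightarrow> bool" where
  "minimising_sequence f s \<longleftrightarrow>
     (\<forall>k. s k > 0) \<and> (\<lambda>k. ereal (f (s k))) \<longlonglongrightarrow> (INF lam\<in>{0<..}. ereal (f lam))"

text \<open>A minimiser over the open half-line need not exist as a real number; that it is infinite or
  finite is by convention a statement about all minimising sequences.\<close>

definition argmin_infinite :: "(real \<Rightarrow> real) \<Rightarrow> bool" where
  "argmin_infinite f \<longleftrightarrow>
     (\<forall>s. minimising_sequence f s \<longrightarrow> filterlim s at_top sequentially)"

definition argmin_finite :: "(real \<Rightarrow> real) \<Rightarrow> bool" where
  "argmin_finite f \<longleftrightarrow> (\<forall>s. minimising_sequence f s \<longrightarrow> bounded (range s))"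

end

theory Submission
  imports Defs "HOL-Probability.Characteristic_Functions"
begin

text \<open>Write \<open>A\<close> for the kernel matrix at scale \<open>\<lambda>\<close> and \<open>W\<close> for the centred data. As \<open>\<lambda> \<rightarrow> \<infinity>\<close>, all
  entries of \<open>A\<close> tend to \<open>\<Phi> 0\<close>, so \<open>A\<close> degenerates to a matrix of rank one whose range consists of
  the constant vectors, and \<open>ln det A \<rightarrow> -\<infinity>\<close>. The outcome depends on the term
  \<open>W \<bullet> A\<^sup>-\<^sup>1 W = sup\<^sub>a (a \<bullet> W)\<^sup>2 / (a \<bullet> A a)\<close>, and three bounds on \<open>a \<bullet> A a\<close> decide it.

  \<^item> There is a constant \<open>M\<close> independent of \<open>\<lambda>\<close> with \<open>(\<Sum>i. a i)\<^sup>2 \<le> M (a \<bullet> A a)\<close>. Hence the data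
    term stays bounded for constant \<open>W\<close>, and the loss tends to \<open>-\<infinity>\<close>.
  \<^item> The form is coercive with a constant that decays at most polynomially in \<open>\<lambda>\<close>, and does not
    degenerate as \<open>\<lambda> \<rightarrow> 0\<close>. Hence \<open>ln det A \<ge> k\<^sub>1 - k\<^sub>2 ln (\<lambda>\<^sup>2 + d)\<close> for all \<open>\<lambda> > 0\<close>. In
    particular the loss is bounded below on bounded sets of scales, so in the constant case every
    minimising sequence diverges.
  \<^item> If \<open>\<Sum>i. a i = 0\<close>, then \<open>a \<bullet> A a\<close> is of order at most \<open>\<lambda> powr (- 2 g)\<close> for some \<open>g > 0\<close>. If
    \<open>W\<close> is not constant, its deviation from the mean is such a vector \<open>a\<close> with \<open>a \<bullet> W > 0\<close>. Hence the
    data term grows at least like a positive power of \<open>\<lambda>\<close> and outweighs the logarithm.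

  The first two bounds are \<open>kernel_matrix_coercive\<close> and rest on the lower bound for the Fourier
  transform of \<open>\<Phi>\<close>. That bound makes \<open>\<Phi>\<close> dominate a multiple of each Gaussian kernel
  (\<open>gaussian_sum_square_le\<close>), so that \<open>\<bar>\<Sum>i. a i h (z i)\<bar>\<close> is controlled by the form for every Gaussian
  \<open>h\<close>, with a constant that depends only on the width of \<open>h\<close>. Products of Gaussians are Gaussians,
  and inclusion--exclusion builds from them functions that equal \<open>1\<close> at all data points, or that
  vanish at all data points but one (\<open>kernel_form_coercive\<close>). The constant function does not
  belong to the reproducing kernel Hilbert space, but the functions of the first kind agree with it
  at the data points. The third bound is \<open>kernel_form_le_of_sum_zero\<close> and rests on the upper bound
  for the Fourier transform.

  Fourier inversion enters only through \<open>kernel_form_mollified_limit\<close>, which writes a quadratic form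
  as a limit of Gaussian-weighted integrals of the Fourier transform.\<close>

section \<open>Gaussians and their Fourier transforms\<close>

definition gaussian :: "real \<Rightarrow> 'a::real_normed_vector \<Rightarrow> real" where
  "gaussian r v = exp (- (r * (norm v)\<^sup>2))"

lemma gaussian_nonneg [simp]: "0 \<le> gaussian r v"
  by (simp add: gaussian_def)

lemma gaussian_le_1: "0 \<le> r \<Longrightarrow> gaussian r v \<le> 1"
  by (simp add: gaussian_def)

lemma continuous_on_gaussian: "continuous_on A (gaussian r)"
  unfolding gaussian_def[abs_def] by (intro continuous_intros)

lemma borel_measurable_gaussian [measurable]:
  "gaussian r \<in> borel_measurable (borel :: 'a::euclidean_space measure)"
  by (intro borel_measurable_continuous_onI continuous_on_gaussian)

lemma gaussian_minus_commute: "gaussian r (x - y) = gaussian r (y - x)"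
  by (simp add: gaussian_def norm_minus_commute)

text \<open>Lebesgue measure on a Euclidean space is the image of the product of one-dimensional Lebesgue
  measures over the basis, so integrals of products of functions of single coordinates factor.\<close>

lemma has_bochner_integral_lborel_prod:
  fixes f :: "'a::euclidean_space \<Rightarrow> real \<Rightarrow> 'b::{real_normed_field,banach,second_countable_topology}"
  assumes f: "\<And>b. b \<in> Basis \<Longrightarrow> integrable lborel (f b)"
  shows "has_bochner_integral lborel (\<lambda>w. \<Prod>b\<in>Basis. f b (w \<bullet> b)) (\<Prod>b\<in>Basis. integral\<^sup>L lborel (f b))"
proof -
  interpret product_sigma_finite "\<lambda>b::'a. lborel :: real measure"
    by (simp add: product_sigma_finite_def lborel.sigma_finite_measure_axioms)
  have m: "(\<lambda>g. \<Sum>b\<in>Basis. g b *\<^sub>R b) \<in> (\<Pi>\<^sub>M b\<in>(Basis::'a set). (lborel::real measure)) \<rightarrow>\<^sub>M borel"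
    by measurable
  have [measurable]: "f b \<in> borel_measurable borel" if "b \<in> Basis" for b
    using borel_measurable_integrable[OF f[OF that]] by simp
  have F: "(\<lambda>w. \<Prod>b\<in>Basis. f b (w \<bullet> b)) \<in> borel_measurable (borel :: 'a measure)"
    by measurable
  have eq: "(\<Prod>b\<in>Basis. f b ((\<Sum>c\<in>Basis. g c *\<^sub>R c) \<bullet> b)) = (\<Prod>b\<in>Basis. f b (g b))"
    for g :: "'a \<Rightarrow> real"
    by (intro prod.cong refl) simp
  have int: "integrable lborel (\<lambda>w::'a. \<Prod>b\<in>Basis. f b (w \<bullet> b))"
    by (subst lborel_eq, subst integrable_distr_eq[OF m F], subst eq)
       (intro product_integrable_prod finite_Basis f)
  have "integral\<^sup>L lborel (\<lambda>w::'a. \<Prod>b\<in>Basis. f b (w \<bullet> b)) = (\<Prod>b\<in>Basis. integral\<^sup>L lborel (f b))"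
    by (subst lborel_eq, subst integral_distr[OF m F], subst eq)
       (intro product_integral_prod finite_Basis f)
  with int show ?thesis
    by (simp add: has_bochner_integral_iff)
qed

lemma lborel_integral_affine:
  fixes f :: "'a::euclidean_space \<Rightarrow> 'b::{banach, second_countable_topology}"
  assumes [measurable]: "f \<in> borel_measurable borel" and c: "c \<noteq> 0"
  shows "(\<integral>x. f x \<partial>lborel) = \<bar>c\<bar> ^ DIM('a) *\<^sub>R (\<integral>x. f (t + c *\<^sub>R x) \<partial>lborel)"
  by (subst lborel_affine[OF c, of t])
     (simp add: integral_density integral_distr)

text \<open>The characteristic function of the standard normal distribution, freed of its normalising
  constant.\<close>

lemma has_bochner_integral_std_gaussian:
  "has_bochner_integral lborel (\<lambda>x. iexp (t * x) * of_real (exp (- x\<^sup>2 / 2)))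
     (complex_of_real (sqrt (2 * pi) * exp (- t\<^sup>2 / 2)))"
proof -
  have int: "integrable std_normal_distribution (\<lambda>x. iexp (t * x))"
    by (intro finite_measure.integrable_const_bound[where B=1])
       (auto simp: prob_space_normal_density prob_space.finite_measure)
  have eq: "(CLINT x|std_normal_distribution. iexp (t * x)) = of_real (exp (- t\<^sup>2 / 2))"
    using fun_cong[OF char_std_normal_distribution, of t] by (simp add: char_def)
  have "has_bochner_integral lborel (\<lambda>x. std_normal_density x *\<^sub>R iexp (t * x)) (of_real (exp (- t\<^sup>2 / 2)))"
    using int eq
    by (subst (asm) integrable_density, simp, simp, simp, subst (asm) integral_density)
       (simp_all add: has_bochner_integral_iff)
  hence "has_bochner_integral lborel (\<lambda>x. of_real (sqrt (2 * pi)) * (std_normal_density x *\<^sub>R iexp (t * x)))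
      (of_real (sqrt (2 * pi)) * of_real (exp (- t\<^sup>2 / 2)))"
    by (rule has_bochner_integral_mult_right)
  moreover have "of_real (sqrt (2 * pi)) * (std_normal_density x *\<^sub>R iexp (t * x))
      = iexp (t * x) * complex_of_real (exp (- x\<^sup>2 / 2))" for x
    by (simp add: std_normal_density_def scaleR_conv_of_real)
  ultimately show ?thesis by simp
qed

lemma has_bochner_integral_gaussian_real:
  assumes r: "r > 0"
  shows "has_bochner_integral lborel (\<lambda>x. iexp (t * x) * of_real (exp (- (r * x\<^sup>2))))
     (complex_of_real (sqrt (pi / r) * exp (- t\<^sup>2 / (4 * r))))"
proof -
  define c where "c = 1 / sqrt (2 * r)"
  have c: "c > 0" "c\<^sup>2 = 1 / (2 * r)" using r by (auto simp: c_def power_divide)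
  have e: "iexp (t * (0 + c * x)) * complex_of_real (exp (- (r * (0 + c * x)\<^sup>2)))
      = iexp ((t * c) * x) * complex_of_real (exp (- x\<^sup>2 / 2))" for x
    using r by (simp add: power_mult_distrib c algebra_simps)
  have s: "sqrt (2 * pi) * c = sqrt (pi / r)"
    using r by (simp add: c_def real_sqrt_mult real_sqrt_divide)
  have v: "complex_of_real (sqrt (2 * pi) * exp (- (t * c)\<^sup>2 / 2))
      = complex_of_real (sqrt (pi / r) * exp (- t\<^sup>2 / (4 * r))) /\<^sub>R \<bar>c\<bar>"
    using c(1) by (simp add: s[symmetric] power_mult_distrib c(2) scaleR_conv_of_real field_simps)
  show ?thesis
    using has_bochner_integral_std_gaussian[of "t * c"] c(1)
    unfolding v e[symmetric]
    by (subst lborel_has_bochner_integral_real_affine_iff[where c=c and t=0]) simp_all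
qed

text \<open>Both the Gaussian and the character factor over the coordinates, which reduces the formula to
  dimension one.\<close>

lemma has_bochner_integral_gaussian_fourier:
  fixes u :: "'a::euclidean_space"
  assumes r: "r > 0"
  shows "has_bochner_integral lborel (\<lambda>w. iexp (u \<bullet> w) * of_real (gaussian r w))
     (complex_of_real (sqrt (pi / r) ^ DIM('a) * gaussian (1 / (4 * r)) u))"
proof -
  let ?f = "\<lambda>b x. iexp ((u \<bullet> b) * x) * complex_of_real (exp (- (r * x\<^sup>2)))"
  have norm_sum: "(norm w)\<^sup>2 = (\<Sum>b\<in>Basis. (w \<bullet> b)\<^sup>2)" for w :: 'a
    unfolding power2_norm_eq_inner by (subst euclidean_inner) (simp add: power2_eq_square)
  have prod: "(\<Prod>b\<in>Basis. ?f b (w \<bullet> b)) = iexp (u \<bullet> w) * of_real (gaussian r w)" for w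
    by (simp add: prod.distrib exp_sum[symmetric] gaussian_def norm_sum euclidean_inner[of u w]
        sum_distrib_left sum_negf[symmetric] of_real_prod[symmetric] del: of_real_prod)
  have "has_bochner_integral lborel (\<lambda>w::'a. \<Prod>b\<in>Basis. ?f b (w \<bullet> b))
      (\<Prod>b\<in>Basis. integral\<^sup>L lborel (?f b))"
    using has_bochner_integral_gaussian_real[OF r]
    by (intro has_bochner_integral_lborel_prod) (auto simp: has_bochner_integral_iff)
  also have "(\<Prod>b\<in>Basis. integral\<^sup>L lborel (?f b))
      = (\<Prod>b\<in>(Basis::'a set). complex_of_real (sqrt (pi / r) * exp (- (u \<bullet> b)\<^sup>2 / (4 * r))))"
    using has_bochner_integral_gaussian_real[OF r]
    by (intro prod.cong refl) (auto simp: has_bochner_integral_iff)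
  also have "\<dots> = complex_of_real (sqrt (pi / r) ^ DIM('a) * gaussian (1 / (4 * r)) u)"
    by (simp add: prod.distrib exp_sum[symmetric] gaussian_def norm_sum sum_divide_distrib
         sum_negf[symmetric] of_real_prod[symmetric] del: of_real_prod)
  finally show ?thesis by (simp only: prod)
qed

lemma has_bochner_integral_gaussian:
  assumes r: "r > 0"
  shows "has_bochner_integral lborel (gaussian r :: 'a::euclidean_space \<Rightarrow> real) (sqrt (pi / r) ^ DIM('a))"
proof -
  have "has_bochner_integral lborel (\<lambda>w::'a. complex_of_real (gaussian r w))
      (complex_of_real (sqrt (pi / r) ^ DIM('a)))"
    using has_bochner_integral_gaussian_fourier[OF r, of "0::'a"] by (simp add: gaussian_def)
  from has_bochner_integral_Re[OF this] show ?thesis by simp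
qed

lemma fourier_transform_gaussian:
  fixes u :: "'a::euclidean_space"
  assumes r: "r > 0"
  shows "fourier_transform (gaussian r) u
    = complex_of_real (sqrt (pi / r) ^ DIM('a) * gaussian (1 / (4 * r)) u)"
  using has_bochner_integral_gaussian_fourier[OF r, of "-u"]
  by (simp add: fourier_transform_def has_bochner_integral_iff gaussian_def mult.commute)

section \<open>Quadratic forms of translation-invariant kernels on the Fourier side\<close>

text \<open>Fourier inversion with a Gaussian cut-off. By Fubini the inner integral over \<open>\<xi>\<close> is the
  Fourier transform of a Gaussian of width \<open>1 / s\<close>, that is, a Gaussian bump of width of order \<open>s\<close>
  around \<open>u\<close>. The cut-off makes every integral absolutely convergent although the Fourier
  transform of \<open>f\<close> itself need not be integrable.\<close>

lemma fourier_transform_mollified: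
  fixes f :: "'a::euclidean_space \<Rightarrow> real"
  assumes f: "integrable lborel f" and s: "s > 0"
  shows "has_bochner_integral lborel
     (\<lambda>\<xi>. iexp (u \<bullet> \<xi>) * fourier_transform f \<xi> * of_real (gaussian (s\<^sup>2) \<xi>))
     (complex_of_real ((2 * sqrt pi) ^ DIM('a) * (\<integral>w. f (u + (2 * s) *\<^sub>R w) * gaussian 1 w \<partial>lborel)))"
proof -
  \<comment> \<open>The joint integrand; integrating out \<open>y\<close> gives the left-hand side, integrating out \<open>\<xi>\<close> the right-hand side.\<close>
  define F where "F = (\<lambda>(\<xi>, y). of_real (f y) * iexp ((u - y) \<bullet> \<xi>) * complex_of_real (gaussian (s\<^sup>2) \<xi>))"
  have s2: "s\<^sup>2 > 0" using s by simp
  have [measurable]: "f \<in> borel_measurable borel"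
    using borel_measurable_integrable[OF f] by simp
  have Fm [measurable]: "F \<in> borel_measurable (lborel \<Otimes>\<^sub>M lborel)"
    unfolding F_def by measurable
  have gauss: "integrable lborel (gaussian (s\<^sup>2) :: 'a \<Rightarrow> real)"
    using has_bochner_integral_gaussian[OF s2] by (auto simp: has_bochner_integral_iff)
  have normF: "norm (F (\<xi>, y)) = \<bar>f y\<bar> * gaussian (s\<^sup>2) \<xi>" for \<xi> y
    by (simp add: F_def norm_mult)
  have absf: "integrable lborel (\<lambda>y. \<bar>f y\<bar>)" using f by simp
  have slice: "integrable lborel (\<lambda>y. F (\<xi>, y))" for \<xi>
  proof (rule Bochner_Integration.integrable_bound)
    show "integrable lborel (\<lambda>y. \<bar>f y\<bar> * gaussian (s\<^sup>2) \<xi>)" using absf by simp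
  qed (auto simp: normF abs_mult)
  have F: "integrable (lborel \<Otimes>\<^sub>M lborel) F"
  proof (rule lborel_pair.Fubini_integrable[OF Fm])
    show "integrable lborel (\<lambda>x. \<integral>y. norm (F (x, y)) \<partial>lborel)"
      unfolding normF using gauss by simp
  qed (use slice in simp)
  have 1: "(\<integral>y. F (\<xi>, y) \<partial>lborel) = iexp (u \<bullet> \<xi>) * fourier_transform f \<xi> * of_real (gaussian (s\<^sup>2) \<xi>)" for \<xi>
  proof -
    have "F (\<xi>, y) = (iexp (u \<bullet> \<xi>) * of_real (gaussian (s\<^sup>2) \<xi>))
        * (complex_of_real (f y) * exp (- \<i> * complex_of_real (\<xi> \<bullet> y)))" for y
      by (simp add: F_def inner_diff_left algebra_simps exp_diff exp_minus inner_commute field_simps)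
    thus ?thesis by (simp add: fourier_transform_def)
  qed
  have 2: "(\<integral>\<xi>. F (\<xi>, y) \<partial>lborel)
      = of_real ((sqrt pi / s) ^ DIM('a) * (f y * gaussian (1 / (4 * s\<^sup>2)) (u - y)))" for y
    using has_bochner_integral_gaussian_fourier[OF s2, of "u - y"] s
    by (simp add: F_def has_bochner_integral_iff mult.assoc real_sqrt_divide)
  have "(\<integral>\<xi>. \<integral>y. F (\<xi>, y) \<partial>lborel \<partial>lborel) = (\<integral>y. \<integral>\<xi>. F (\<xi>, y) \<partial>lborel \<partial>lborel)"
    using lborel_pair.Fubini_integral[of "\<lambda>\<xi> y. F (\<xi>, y)"] F by simp
  also have "\<dots> = of_real ((sqrt pi / s) ^ DIM('a) * (\<integral>y. f y * gaussian (1 / (4 * s\<^sup>2)) (u - y) \<partial>lborel))"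
    unfolding 2 integral_complex_of_real integral_mult_right_zero by simp
  also have "(\<integral>y. f y * gaussian (1 / (4 * s\<^sup>2)) (u - y) \<partial>lborel)
      = (2 * s) ^ DIM('a) * (\<integral>w. f (u + (2 * s) *\<^sub>R w) * gaussian 1 w \<partial>lborel)"
    using s by (subst lborel_integral_affine[where c="2 * s" and t=u])
      (simp_all add: gaussian_def power_mult_distrib)
  also have "(sqrt pi / s) ^ DIM('a) * ((2 * s) ^ DIM('a) * (\<integral>w. f (u + (2 * s) *\<^sub>R w) * gaussian 1 w \<partial>lborel))
      = (2 * sqrt pi) ^ DIM('a) * (\<integral>w. f (u + (2 * s) *\<^sub>R w) * gaussian 1 w \<partial>lborel)"
    using s by (simp add: power_mult_distrib power_divide)
  finally show ?thesis
    using lborel_pair.integrable_fst'[OF F] unfolding 1 by (simp add: has_bochner_integral_iff)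
qed

lemma gaussian_average_tendsto:
  fixes f :: "'a::euclidean_space \<Rightarrow> real"
  assumes f: "continuous_on UNIV f" and B: "\<And>v. \<bar>f v\<bar> \<le> B" and s: "s \<longlonglongrightarrow> 0"
  shows "(\<lambda>k. \<integral>w. f (u + (2 * s k) *\<^sub>R w) * gaussian 1 w \<partial>lborel) \<longlonglongrightarrow> f u * sqrt pi ^ DIM('a)"
proof -
  have [measurable]: "f \<in> borel_measurable borel"
    using f by (rule borel_measurable_continuous_onI)
  have gauss: "has_bochner_integral lborel (gaussian 1 :: 'a \<Rightarrow> real) (sqrt pi ^ DIM('a))"
    using has_bochner_integral_gaussian[of 1] by simp
  have "(\<lambda>k. \<integral>w. f (u + (2 * s k) *\<^sub>R w) * gaussian 1 w \<partial>lborel) \<longlonglongrightarrow> (\<integral>w. f u * gaussian 1 (w::'a) \<partial>lborel)"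
  proof (rule integral_dominated_convergence[where w="\<lambda>w. B * gaussian 1 w"])
    show "integrable lborel (\<lambda>w::'a. B * gaussian 1 w)"
      using gauss by (simp add: has_bochner_integral_iff)
    show "AE w in lborel. (\<lambda>k. f (u + (2 * s k) *\<^sub>R w) * gaussian 1 w) \<longlonglongrightarrow> f u * gaussian 1 w"
    proof (rule AE_I2)
      fix w :: 'a
      have "(\<lambda>k. u + (2 * s k) *\<^sub>R w) \<longlonglongrightarrow> u + (2 * 0) *\<^sub>R w"
        by (intro tendsto_intros s)
      moreover have "isCont f u" using f by (simp add: continuous_on_eq_continuous_at)
      ultimately have "(\<lambda>k. f (u + (2 * s k) *\<^sub>R w)) \<longlonglongrightarrow> f u"
        by (intro isCont_tendsto_compose[of u f]) simp_all
      thus "(\<lambda>k. f (u + (2 * s k) *\<^sub>R w) * gaussian 1 w) \<longlonglongrightarrow> f u * gaussian 1 w"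
        by (intro tendsto_intros)
    qed
    show "AE w in lborel. norm (f (u + (2 * s k) *\<^sub>R w) * gaussian 1 w) \<le> B * gaussian 1 w" for k
      using B by (intro AE_I2) (simp add: abs_mult mult_right_mono)
  qed simp_all
  also have "(\<integral>w. f u * gaussian 1 w \<partial>(lborel :: 'a measure)) = f u * sqrt pi ^ DIM('a)"
    using gauss by (simp add: has_bochner_integral_iff)
  finally show ?thesis .
qed

text \<open>The index set and the index type are arbitrary so that a further point can be adjoined to a
  configuration.\<close>

definition kernel_form :: "('a::real_vector \<Rightarrow> real) \<Rightarrow> 'i set \<Rightarrow> ('i \<Rightarrow> 'a) \<Rightarrow> ('i \<Rightarrow> real) \<Rightarrow> real" where
  "kernel_form f I z a = (\<Sum>i\<in>I. \<Sum>j\<in>I. a i * a j * f (z i - z j))"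

definition trig_sum :: "'i set \<Rightarrow> ('i \<Rightarrow> 'a::real_inner) \<Rightarrow> ('i \<Rightarrow> real) \<Rightarrow> 'a \<Rightarrow> complex" where
  "trig_sum I z a \<xi> = (\<Sum>i\<in>I. of_real (a i) * iexp (z i \<bullet> \<xi>))"

lemma trig_sum_norm_square:
  "complex_of_real ((cmod (trig_sum I z a \<xi>))\<^sup>2)
     = (\<Sum>i\<in>I. \<Sum>j\<in>I. of_real (a i * a j) * iexp ((z i - z j) \<bullet> \<xi>))"
proof -
  have "complex_of_real ((cmod (trig_sum I z a \<xi>))\<^sup>2) = trig_sum I z a \<xi> * cnj (trig_sum I z a \<xi>)"
    by (rule complex_norm_square)
  also have "\<dots> = (\<Sum>i\<in>I. \<Sum>j\<in>I. (of_real (a i) * iexp (z i \<bullet> \<xi>)) * (of_real (a j) * exp (- (\<i> * of_real (z j \<bullet> \<xi>)))))"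
    by (simp add: trig_sum_def sum_product exp_cnj)
  also have "\<dots> = (\<Sum>i\<in>I. \<Sum>j\<in>I. of_real (a i * a j) * iexp ((z i - z j) \<bullet> \<xi>))"
    by (intro sum.cong refl)
       (simp add: inner_diff_left exp_diff exp_minus right_diff_distrib divide_inverse)
  finally show ?thesis .
qed

text \<open>The substitute for Fourier inversion. A quadratic form of the kernel \<open>f (u - v)\<close> is the limit of
  integrals of the Fourier transform of \<open>f\<close> against the non-negative weight \<open>|trig_sum|\<^sup>2\<close>; hence
  pointwise bounds on the Fourier transform become bounds on the form. Taking real parts is harmless
  because the weight and the form are real.\<close>

lemma
  fixes f :: "'a::euclidean_space \<Rightarrow> real" and z :: "'i \<Rightarrow> 'a" and a :: "'i \<Rightarrow> real"
  assumes I: "finite I" and int: "integrable lborel f" and f: "continuous_on UNIV f"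
    and B: "\<And>v. \<bar>f v\<bar> \<le> B"
  defines "G \<equiv> (\<lambda>(k::nat) \<xi>. (cmod (trig_sum I z a \<xi>))\<^sup>2 * Re (fourier_transform f \<xi>) * gaussian ((inverse (Suc k))\<^sup>2) \<xi>)"
  shows integrable_mollified_form: "integrable lborel (G k)"
    and kernel_form_mollified_limit:
      "(\<lambda>k. \<integral>\<xi>. G k \<xi> \<partial>lborel) \<longlonglongrightarrow> (2 * pi) ^ DIM('a) * kernel_form f I z a"
proof -
  define s where "s = (\<lambda>k. inverse (real (Suc k)))"
  define h where "h = (\<lambda>k u. \<integral>w. f (u + (2 * s k) *\<^sub>R w) * gaussian 1 w \<partial>lborel)"
  have s: "s k > 0" for k by (simp add: s_def)
  have "has_bochner_integral lborel
     (\<lambda>\<xi>. \<Sum>i\<in>I. \<Sum>j\<in>I. of_real (a i * a j) * (iexp ((z i - z j) \<bullet> \<xi>) * fourier_transform f \<xi> * of_real (gaussian ((s k)\<^sup>2) \<xi>)))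
     (\<Sum>i\<in>I. \<Sum>j\<in>I. of_real (a i * a j) * (complex_of_real ((2 * sqrt pi) ^ DIM('a) * h k (z i - z j))))" for k
    unfolding h_def
    by (intro has_bochner_integral_sum has_bochner_integral_mult_right fourier_transform_mollified int s)
  moreover have "(\<Sum>i\<in>I. \<Sum>j\<in>I. of_real (a i * a j) * (iexp ((z i - z j) \<bullet> \<xi>) * fourier_transform f \<xi> * of_real (gaussian ((s k)\<^sup>2) \<xi>)))
     = of_real ((cmod (trig_sum I z a \<xi>))\<^sup>2) * fourier_transform f \<xi> * of_real (gaussian ((s k)\<^sup>2) \<xi>)" for k \<xi>
    unfolding trig_sum_norm_square sum_distrib_right by (simp only: mult.assoc)
  moreover have "(\<Sum>i\<in>I. \<Sum>j\<in>I. of_real (a i * a j) * (complex_of_real ((2 * sqrt pi) ^ DIM('a) * h k (z i - z j))))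
     = of_real (\<Sum>i\<in>I. \<Sum>j\<in>I. a i * a j * ((2 * sqrt pi) ^ DIM('a) * h k (z i - z j)))" for k
    by simp
  ultimately have "has_bochner_integral lborel
     (\<lambda>\<xi>. of_real ((cmod (trig_sum I z a \<xi>))\<^sup>2) * fourier_transform f \<xi> * of_real (gaussian ((s k)\<^sup>2) \<xi>))
     (complex_of_real (\<Sum>i\<in>I. \<Sum>j\<in>I. a i * a j * ((2 * sqrt pi) ^ DIM('a) * h k (z i - z j))))" for k
    by (simp only:)
  note Q = has_bochner_integral_Re[OF this]
  have Re: "Re (of_real x * w * of_real y) = x * Re w * y" for x y w by simp
  have G: "has_bochner_integral lborel (G k)
     (\<Sum>i\<in>I. \<Sum>j\<in>I. a i * a j * ((2 * sqrt pi) ^ DIM('a) * h k (z i - z j)))" for k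
    using Q[of k] unfolding G_def s_def Re Re_complex_of_real .
  show "integrable lborel (G k)" using G by (simp add: has_bochner_integral_iff)
  have s0: "s \<longlonglongrightarrow> 0" unfolding s_def by (rule LIMSEQ_inverse_real_of_nat)
  have "(\<lambda>k. \<Sum>i\<in>I. \<Sum>j\<in>I. a i * a j * ((2 * sqrt pi) ^ DIM('a) * h k (z i - z j)))
     \<longlonglongrightarrow> (\<Sum>i\<in>I. \<Sum>j\<in>I. a i * a j * ((2 * sqrt pi) ^ DIM('a) * (f (z i - z j) * sqrt pi ^ DIM('a))))"
    unfolding h_def by (intro tendsto_sum tendsto_mult_left gaussian_average_tendsto[OF f B s0])
  also have "(\<Sum>i\<in>I. \<Sum>j\<in>I. a i * a j * ((2 * sqrt pi) ^ DIM('a) * (f (z i - z j) * sqrt pi ^ DIM('a))))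
     = (2 * pi) ^ DIM('a) * kernel_form f I z a"
  proof -
    have "(2 * sqrt pi) ^ DIM('a) * sqrt pi ^ DIM('a) = (2 * sqrt pi * sqrt pi) ^ DIM('a)"
      by (simp only: power_mult_distrib)
    moreover have "2 * sqrt pi * sqrt pi = 2 * pi" by simp
    ultimately have c: "(2 * sqrt pi) ^ DIM('a) * sqrt pi ^ DIM('a) = (2 * pi) ^ DIM('a)"
      by (simp only:)
    show ?thesis unfolding kernel_form_def c[symmetric] sum_distrib_left
      by (intro sum.cong refl) (simp only: mult_ac)
  qed
  finally show "(\<lambda>k. \<integral>\<xi>. G k \<xi> \<partial>lborel) \<longlonglongrightarrow> (2 * pi) ^ DIM('a) * kernel_form f I z a"
    using G by (simp add: has_bochner_integral_iff)
qed

text \<open>The easy half of Bochner's theorem.\<close>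

lemma kernel_form_nonneg:
  fixes f :: "'a::euclidean_space \<Rightarrow> real"
  assumes "finite I" "integrable lborel f" "continuous_on UNIV f" "\<And>v. \<bar>f v\<bar> \<le> B"
    and pos: "\<And>\<xi>. 0 \<le> Re (fourier_transform f \<xi>)"
  shows "0 \<le> kernel_form f I z a"
proof -
  have "0 \<le> (2 * pi) ^ DIM('a) * kernel_form f I z a"
    by (rule LIMSEQ_le_const[OF kernel_form_mollified_limit[OF assms(1-4)]],
        intro exI allI impI integral_nonneg_AE AE_I2 mult_nonneg_nonneg pos) simp_all
  moreover have "(2 * pi) ^ DIM('a) > 0" by simp
  ultimately show ?thesis unfolding zero_le_mult_iff by linarith
qed

lemma kernel_form_le_integral:
  fixes f :: "'a::euclidean_space \<Rightarrow> real"
  assumes "finite I" "integrable lborel f" "continuous_on UNIV f" "\<And>v. \<bar>f v\<bar> \<le> B"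
    and H: "\<And>\<xi>. Re (fourier_transform f \<xi>) \<le> H \<xi>" "\<And>\<xi>. 0 \<le> H \<xi>"
    and D: "\<And>\<xi>. (cmod (trig_sum I z a \<xi>))\<^sup>2 * H \<xi> \<le> D \<xi>" "integrable lborel D"
  shows "(2 * pi) ^ DIM('a) * kernel_form f I z a \<le> (\<integral>\<xi>. D \<xi> \<partial>lborel)"
proof (rule LIMSEQ_le_const2[OF kernel_form_mollified_limit[OF assms(1-4)]], intro exI allI impI, rule integral_mono)
  fix k :: nat and \<xi> :: 'a
  show "integrable lborel (\<lambda>\<xi>. (cmod (trig_sum I z a \<xi>))\<^sup>2 * Re (fourier_transform f \<xi>)
        * gaussian ((inverse (real (Suc k)))\<^sup>2) \<xi>)"
    by (rule integrable_mollified_form[OF assms(1-4)])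
  have "(cmod (trig_sum I z a \<xi>))\<^sup>2 * Re (fourier_transform f \<xi>) * gaussian ((inverse (real (Suc k)))\<^sup>2) \<xi>
     \<le> (cmod (trig_sum I z a \<xi>))\<^sup>2 * H \<xi> * 1"
    using H by (intro mult_mono mult_left_mono gaussian_le_1) auto
  also have "\<dots> \<le> D \<xi>" using D by simp
  finally show "(cmod (trig_sum I z a \<xi>))\<^sup>2 * Re (fourier_transform f \<xi>)
      * gaussian ((inverse (real (Suc k)))\<^sup>2) \<xi> \<le> D \<xi>" .
qed (rule D)

section \<open>Comparison with Gaussian kernels\<close>

text \<open>This is the Cauchy--Schwarz inequality in the reproducing kernel Hilbert space of the Gaussian:
  the sum on the left is the inner product of \<open>\<Sum>i. a i \<cdot> k (z i)\<close> with the unit vector \<open>k c\<close>. It is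
  obtained from positivity of the form for the configuration enlarged by the point \<open>c\<close>.\<close>

lemma gaussian_sum_square_le_kernel_form:
  fixes z :: "'i \<Rightarrow> 'a::euclidean_space"
  assumes I: "finite I" and r: "r > 0"
  shows "(\<Sum>i\<in>I. a i * gaussian r (z i - c))\<^sup>2 \<le> kernel_form (gaussian r) I z a"
proof -
  define s where "s = (\<Sum>i\<in>I. a i * gaussian r (z i - c))"
  \<comment> \<open>\<open>None\<close> is the index of the adjoined point \<open>c\<close>; the weight \<open>- s\<close> minimises the enlarged form.\<close>
  define z' where "z' = case_option c z"
  define a' where "a' = case_option (- s) a"
  have "0 \<le> kernel_form (gaussian r) (insert None (Some ` I)) z' a'"
  proof (rule kernel_form_nonneg[where B=1])
    show "integrable lborel (gaussian r :: 'a \<Rightarrow> real)"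
      using has_bochner_integral_gaussian[OF r] by (auto simp: has_bochner_integral_iff)
  qed (use I r in \<open>simp_all add: continuous_on_gaussian gaussian_le_1 fourier_transform_gaussian less_imp_le\<close>)
  also have "\<dots> = s\<^sup>2 - s * s - s * s + kernel_form (gaussian r) I z a"
  proof -
    have g0: "gaussian r (0::'a) = 1" by (simp add: gaussian_def)
    have comm: "gaussian r (c - z j) = gaussian r (z j - c)" for j by (rule gaussian_minus_commute)
    have 1: "(\<Sum>j\<in>I. - s * a j * gaussian r (z j - c)) = - s * s"
      by (simp only: mult.assoc sum_distrib_left[symmetric] s_def)
    have 2: "(\<Sum>j\<in>I. a j * - s * gaussian r (z j - c)) = - s * s"
      unfolding 1[symmetric] by (simp only: mult.commute)
    have "kernel_form (gaussian r) (insert None (Some ` I)) z' a'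
        = s\<^sup>2 + (\<Sum>j\<in>I. - s * a j * gaussian r (z j - c))
          + ((\<Sum>j\<in>I. a j * - s * gaussian r (z j - c)) + kernel_form (gaussian r) I z a)"
      using I by (simp only: kernel_form_def)
        (simp add: sum.reindex z'_def a'_def g0 comm sum.distrib sum_subtractf sum_negf power2_eq_square)
    thus ?thesis unfolding 1 2 by simp
  qed
  finally show ?thesis by (simp add: s_def power2_eq_square)
qed

text \<open>Exponential decay is faster than algebraic decay; the constant comes from \<open>ln t \<le> t\<close> applied to
  \<open>t = (1 + s) \<eta> / \<alpha>\<close>.\<close>

lemma exp_le_powr_neg:
  fixes \<alpha> \<eta> :: real
  assumes \<alpha>: "\<alpha> > 0" and \<eta>: "\<eta> > 0"
  obtains c where "c > 0" "\<And>s. s \<ge> 0 \<Longrightarrow> c * exp (- \<eta> * s) \<le> (1 + s) powr (- \<alpha>)"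
proof
  fix s :: real assume s: "s \<ge> 0"
  have "ln (1 + s) = ln ((1 + s) * (\<eta> / \<alpha>)) + ln (\<alpha> / \<eta>)"
    using assms s by (simp add: ln_mult ln_div)
  also have "ln ((1 + s) * (\<eta> / \<alpha>)) \<le> (1 + s) * (\<eta> / \<alpha>)"
    using assms s by (intro less_imp_le ln_less_self) simp
  finally have "\<alpha> * ln (1 + s) \<le> \<alpha> * ((1 + s) * (\<eta> / \<alpha>) + ln (\<alpha> / \<eta>))"
    using \<alpha> by simp
  also have "\<dots> = \<eta> * (1 + s) + \<alpha> * ln (\<alpha> / \<eta>)" using \<alpha> by (simp add: field_simps)
  finally show "exp (- (\<eta> + \<alpha> * ln (\<alpha> / \<eta>))) * exp (- \<eta> * s) \<le> (1 + s) powr (- \<alpha>)"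
    using s by (simp add: powr_def exp_add[symmetric] algebra_simps del: exp_add)
qed simp

text \<open>A kernel whose Fourier transform decays only algebraically dominates a multiple of every Gaussian
  kernel, because their difference has a non-negative Fourier transform.\<close>

lemma gaussian_sum_square_le:
  fixes \<Phi> :: "'a::euclidean_space \<Rightarrow> real"
  assumes int: "integrable lborel \<Phi>" and cont: "continuous_on UNIV \<Phi>" and B: "\<And>v. \<bar>\<Phi> v\<bar> \<le> B"
    and C: "C > 0" and \<alpha>: "\<alpha> > 0"
    and lower: "\<And>\<xi>. C * (1 + (norm \<xi>)\<^sup>2) powr (- \<alpha>) \<le> Re (fourier_transform \<Phi> \<xi>)"
    and r: "r > 0"
  shows "\<exists>M. \<forall>(I::'i set) z a c. finite I \<longrightarrow>
     (\<Sum>i\<in>I. a i * gaussian r (z i - c))\<^sup>2 \<le> M * kernel_form \<Phi> I z a"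
proof -
  obtain e where e: "e > 0" "\<And>s. s \<ge> 0 \<Longrightarrow> e * exp (- (1 / (4 * r)) * s) \<le> (1 + s) powr (- \<alpha>)"
    using exp_le_powr_neg[OF \<alpha>, of "1 / (4 * r)"] r by auto
  define g where "g = sqrt (pi / r) ^ DIM('a)"
  have g: "g > 0" using r by (simp add: g_def)
  \<comment> \<open>The factor \<open>g\<close> is the Fourier transform of the Gaussian at the origin.\<close>
  define \<epsilon> where "\<epsilon> = C * e / g"
  have \<epsilon>: "\<epsilon> > 0" using C e g by (simp add: \<epsilon>_def)
  have gint: "integrable lborel (gaussian r :: 'a \<Rightarrow> real)"
    using has_bochner_integral_gaussian[OF r] by (auto simp: has_bochner_integral_iff)
  let ?f = "\<lambda>v. \<Phi> v - \<epsilon> * gaussian r v"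
  have ft: "Re (fourier_transform ?f \<xi>) = Re (fourier_transform \<Phi> \<xi>) - C * (e * gaussian (1 / (4 * r)) \<xi>)" for \<xi>
  proof -
    have ei: "integrable lborel (\<lambda>x. complex_of_real (h x) * exp (- \<i> * complex_of_real (\<xi> \<bullet> x)))"
      if "integrable lborel h" for h :: "'a \<Rightarrow> real"
    proof (rule Bochner_Integration.integrable_bound)
      show "integrable lborel (\<lambda>x. \<bar>h x\<bar>)" using that by simp
      have "h \<in> borel_measurable borel" using borel_measurable_integrable[OF that] by simp
      thus "(\<lambda>x. complex_of_real (h x) * exp (- \<i> * complex_of_real (\<xi> \<bullet> x))) \<in> borel_measurable lborel"
        by measurable
    qed (auto simp: norm_mult)
    have "fourier_transform ?f \<xi> = fourier_transform \<Phi> \<xi> - of_real \<epsilon> * fourier_transform (gaussian r) \<xi>"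
      unfolding fourier_transform_def integral_mult_right_zero[symmetric]
        Bochner_Integration.integral_diff[OF ei[OF int] integrable_mult_right[OF ei[OF gint]], symmetric]
      by (simp add: algebra_simps)
    thus ?thesis
      using g by (simp add: fourier_transform_gaussian[OF r] g_def[symmetric] \<epsilon>_def)
  qed
  have "(\<Sum>i\<in>I. a i * gaussian r (z i - c))\<^sup>2 \<le> (1 / \<epsilon>) * kernel_form \<Phi> I z a"
    if I: "finite I" for I :: "'i set" and z a c
  proof -
    have "0 \<le> kernel_form ?f I z a"
    proof (rule kernel_form_nonneg[where B="B + \<epsilon>", OF I])
      show "integrable lborel ?f" using int gint by simp
      show "continuous_on UNIV ?f" by (intro continuous_intros cont continuous_on_gaussian)
      show "\<bar>?f v\<bar> \<le> B + \<epsilon>" for v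
      proof -
        have "\<bar>?f v\<bar> \<le> \<bar>\<Phi> v\<bar> + \<bar>\<epsilon> * gaussian r v\<bar>" by (rule abs_triangle_ineq4)
        also have "\<bar>\<epsilon> * gaussian r v\<bar> \<le> \<epsilon> * 1"
          unfolding abs_mult using \<epsilon> gaussian_le_1[of r v] r by (intro mult_mono) auto
        finally show ?thesis using B[of v] by simp
      qed
      show "0 \<le> Re (fourier_transform ?f \<xi>)" for \<xi>
      proof -
        have "C * (e * gaussian (1 / (4 * r)) \<xi>) \<le> C * (1 + (norm \<xi>)\<^sup>2) powr (- \<alpha>)"
          using e(2)[of "(norm \<xi>)\<^sup>2"] C by (simp add: gaussian_def)
        thus ?thesis unfolding ft using lower[of \<xi>] by simp
      qed
    qed
    also have "kernel_form ?f I z a = kernel_form \<Phi> I z a - \<epsilon> * kernel_form (gaussian r) I z a"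
      by (simp add: kernel_form_def sum_distrib_left sum_subtractf[symmetric] algebra_simps)
    finally have "\<epsilon> * kernel_form (gaussian r) I z a \<le> kernel_form \<Phi> I z a" by simp
    moreover have "\<epsilon> * (\<Sum>i\<in>I. a i * gaussian r (z i - c))\<^sup>2 \<le> \<epsilon> * kernel_form (gaussian r) I z a"
      using \<epsilon> gaussian_sum_square_le_kernel_form[OF I r] by (intro mult_left_mono) auto
    ultimately have "\<epsilon> * (\<Sum>i\<in>I. a i * gaussian r (z i - c))\<^sup>2 \<le> kernel_form \<Phi> I z a" by linarith
    thus ?thesis using \<epsilon> by (simp add: pos_le_divide_eq mult.commute)
  qed
  thus ?thesis by blast
qed

section \<open>Decay of the form on coefficient vectors with zero sum\<close>

lemma integrable_one_plus_square_powr: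
  assumes p: "p > 1 / 2"
  shows "integrable lborel (\<lambda>t::real. (1 + t\<^sup>2) powr (- p))"
proof -
  define q where "q = 2 * p - 1"
  have q: "q > 0" using p by (simp add: q_def)
  let ?g = "\<lambda>t::real. (1 + \<bar>t\<bar>) powr (- q - 1)"
  let ?F = "\<lambda>t::real. - ((1 + t) powr (- q)) / q"
  have half: "(\<integral>\<^sup>+t. ennreal (?g t) * indicator {0..} t \<partial>lborel) = ennreal (0 - ?F 0)"
  proof (rule nn_integral_FTC_atLeast)
    show "(?F has_real_derivative ?g t) (at t)" if "0 \<le> t" for t
    proof -
      have "((\<lambda>t. (1 + t) powr (- q)) has_real_derivative - q * (1 + t) powr (- q - of_nat 1) * 1) (at t)"
        using that by (intro DERIV_fun_powr) (auto intro!: derivative_eq_intros)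
      from DERIV_cdivide[OF DERIV_minus[OF this], of q] show ?thesis
        using that q by simp
    qed
    show "(?F \<longlongrightarrow> 0) at_top" using q by real_asymp
  qed simp_all
  have "(\<integral>\<^sup>+t. ennreal (?g t) * indicator {..0} t \<partial>lborel)
      = (\<integral>\<^sup>+t. ennreal (?g t) * indicator {0..} t \<partial>lborel)"
    by (subst nn_integral_real_affine[where c="-1" and t=0])
       (auto intro!: nn_integral_cong simp: indicator_def)
  with half have half': "(\<integral>\<^sup>+t. ennreal (?g t) * indicator {..0} t \<partial>lborel) = ennreal (0 - ?F 0)"
    by simp
  have "(\<integral>\<^sup>+t. ennreal (?g t) \<partial>lborel)
      \<le> (\<integral>\<^sup>+t. ennreal (?g t) * indicator {0..} t + ennreal (?g t) * indicator {..0} t \<partial>lborel)"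
    by (intro nn_integral_mono) (auto simp: indicator_def)
  also have "\<dots> = ennreal (0 - ?F 0) + ennreal (0 - ?F 0)"
    by (subst nn_integral_add) (simp_all add: half half')
  finally have g: "integrable lborel ?g"
    by (intro integrableI_bounded) (auto intro: le_less_trans)
  show ?thesis
  proof (rule Bochner_Integration.integrable_bound)
    show "integrable lborel (\<lambda>t. 2 powr p * ?g t)" using g by simp
    show "AE t in lborel. norm ((1 + t\<^sup>2) powr (- p)) \<le> norm (2 powr p * ?g t)"
    proof (rule AE_I2)
      fix t :: real
      have "0 \<le> (1 - \<bar>t\<bar>)\<^sup>2" by simp
      hence "(1 + \<bar>t\<bar>)\<^sup>2 \<le> 2 * (1 + t\<^sup>2)" by (simp add: power2_eq_square algebra_simps)
      hence "(2 * (1 + t\<^sup>2)) powr (- p) \<le> ((1 + \<bar>t\<bar>)\<^sup>2) powr (- p)"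
        using p by (intro powr_mono2') auto
      also have "((1 + \<bar>t\<bar>)\<^sup>2) powr (- p) = ?g t"
        by (simp add: power2_eq_square powr_mult powr_add[symmetric] q_def)
      also have "(2 * (1 + t\<^sup>2)) powr (- p) = 2 powr (- p) * (1 + t\<^sup>2) powr (- p)"
        by (subst powr_mult) simp_all
      finally have "2 powr p * (2 powr (- p) * (1 + t\<^sup>2) powr (- p)) \<le> 2 powr p * ?g t"
        by (rule mult_left_mono) simp
      thus "norm ((1 + t\<^sup>2) powr (- p)) \<le> norm (2 powr p * ?g t)"
        by (simp add: mult.assoc[symmetric] powr_add[symmetric])
    qed
  qed simp
qed

text \<open>Each factor \<open>1 + (\<xi> \<bullet> b)\<^sup>2\<close> is at most \<open>1 + |\<xi>|\<^sup>2\<close>, so the weight is at most a product of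
  one-dimensional weights with exponent \<open>\<beta> / d > 1 / 2\<close>.\<close>

lemma integrable_one_plus_norm_square_powr:
  assumes \<beta>: "\<beta> > real DIM('a::euclidean_space) / 2"
  shows "integrable lborel (\<lambda>\<xi>::'a. (1 + (norm \<xi>)\<^sup>2) powr (- \<beta>))"
proof -
  define p where "p = \<beta> / real DIM('a)"
  have p: "p > 1 / 2" using \<beta> by (simp add: p_def field_simps)
  have "integrable lborel (\<lambda>\<xi>::'a. \<Prod>b\<in>Basis. (1 + (\<xi> \<bullet> b)\<^sup>2) powr (- p))"
    using has_bochner_integral_lborel_prod[of "\<lambda>b::'a. \<lambda>t. (1 + t\<^sup>2) powr (- p)"]
      integrable_one_plus_square_powr[OF p] by (auto simp: has_bochner_integral_iff)
  thus ?thesis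
  proof (rule Bochner_Integration.integrable_bound)
    show "AE \<xi> in lborel. norm ((1 + (norm (\<xi>::'a))\<^sup>2) powr (- \<beta>))
        \<le> norm (\<Prod>b\<in>Basis. (1 + (\<xi> \<bullet> b)\<^sup>2) powr (- p))"
    proof (rule AE_I2)
      fix \<xi> :: 'a
      have "(1 + (norm \<xi>)\<^sup>2) powr (- \<beta>) = (\<Prod>b\<in>(Basis::'a set). (1 + (norm \<xi>)\<^sup>2) powr (- p))"
        by (simp add: prod_constant powr_power p_def add_nonneg_eq_0_iff)
      also have "\<dots> \<le> (\<Prod>b\<in>Basis. (1 + (\<xi> \<bullet> b)\<^sup>2) powr (- p))"
      proof (intro prod_mono conjI powr_mono2')
        fix b :: 'a assume "b \<in> Basis"
        hence "\<bar>\<xi> \<bullet> b\<bar> \<le> norm \<xi>" by (rule Basis_le_norm)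
        thus "1 + (\<xi> \<bullet> b)\<^sup>2 \<le> 1 + (norm \<xi>)\<^sup>2" by (simp add: abs_le_square_iff[symmetric])
      qed (use p in \<open>auto simp: add_pos_nonneg\<close>)
      finally show "norm ((1 + (norm \<xi>)\<^sup>2) powr (- \<beta>))
        \<le> norm (\<Prod>b\<in>Basis. (1 + (\<xi> \<bullet> b)\<^sup>2) powr (- p))" by simp
    qed
  qed simp
qed

text \<open>Interpolation between the bounds \<open>\<bar>t\<bar>\<close> and \<open>2\<close>.\<close>

lemma cmod_iexp_minus_one_le:
  assumes "0 \<le> g" "g \<le> 1" "t \<noteq> 0"
  shows "cmod (iexp t - 1) \<le> 2 * \<bar>t\<bar> powr g"
proof (cases "\<bar>t\<bar> \<le> 1")
  case True
  have "cmod (iexp t - 1) \<le> \<bar>t\<bar> * 1"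
    using iexp_approx1[of t 0] by simp
  also have "\<dots> \<le> \<bar>t\<bar> powr g"
    using True assms powr_mono'[of g 1 "\<bar>t\<bar>"] by simp
  also have "\<dots> \<le> 2 * \<bar>t\<bar> powr g" by simp
  finally show ?thesis .
next
  case False
  have "cmod (iexp t - 1) \<le> cmod (iexp t) + cmod 1" by (rule norm_triangle_ineq4)
  also have "\<dots> = 2 * 1" by simp
  also have "\<dots> \<le> 2 * \<bar>t\<bar> powr g" using False assms by (intro mult_left_mono ge_one_powr_ge_zero) auto
  finally show ?thesis .
qed

text \<open>If the coefficients sum to zero, the trigonometric sum may be formed with \<open>exp (\<i> (z i \<bullet> \<xi>)) - 1\<close>
  instead of the exponential, and is therefore of size \<open>(|z i| |\<xi>|) powr g\<close>. The condition
  \<open>g < \<alpha> - d / 2\<close> leaves enough decay in \<open>\<xi>\<close> to integrate. For points \<open>x i / \<lambda>\<close> the bound is of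
  order \<open>\<lambda> powr (- 2 g)\<close>.\<close>

lemma kernel_form_le_of_sum_zero:
  fixes \<Phi> :: "'a::euclidean_space \<Rightarrow> real"
  assumes int: "integrable lborel \<Phi>" and cont: "continuous_on UNIV \<Phi>" and B: "\<And>v. \<bar>\<Phi> v\<bar> \<le> B"
    and C: "C > 0" and g: "0 \<le> g" "g \<le> 1" "g < \<alpha> - real DIM('a) / 2"
    and upper: "\<And>\<xi>. Re (fourier_transform \<Phi> \<xi>) \<le> C * (1 + (norm \<xi>)\<^sup>2) powr (- \<alpha>)"
  shows "\<exists>M>0. \<forall>(I::'i set) z a. finite I \<longrightarrow> (\<Sum>i\<in>I. a i) = 0 \<longrightarrow>
     kernel_form \<Phi> I z a \<le> M * (\<Sum>i\<in>I. \<bar>a i\<bar> * norm (z i) powr g)\<^sup>2"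
proof -
  define W where "W = (\<integral>\<xi>. (1 + (norm (\<xi>::'a))\<^sup>2) powr (- (\<alpha> - g)) \<partial>lborel)"
  have W: "W \<ge> 0" unfolding W_def by (intro integral_nonneg_AE) auto
  \<comment> \<open>\<open>W + 1\<close> rather than \<open>W\<close> makes positivity of \<open>M\<close> immediate.\<close>
  define M where "M = 4 * C * (W + 1) / (2 * pi) ^ DIM('a)"
  have M: "M > 0" using W C by (simp add: M_def)
  have "kernel_form \<Phi> I z a \<le> M * (\<Sum>i\<in>I. \<bar>a i\<bar> * norm (z i) powr g)\<^sup>2"
    if I: "finite I" and a: "(\<Sum>i\<in>I. a i) = 0" for I :: "'i set" and z a
  proof -
    define A where "A = (\<Sum>i\<in>I. \<bar>a i\<bar> * norm (z i) powr g)"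
    have A: "A \<ge> 0" unfolding A_def by (intro sum_nonneg) auto
    have S: "cmod (trig_sum I z a \<xi>) \<le> 2 * A * norm \<xi> powr g" for \<xi>
    proof -
      have "trig_sum I z a \<xi> = (\<Sum>i\<in>I. of_real (a i) * (iexp (z i \<bullet> \<xi>) - 1))"
        using a by (simp add: trig_sum_def right_diff_distrib sum_subtractf of_real_sum[symmetric] del: of_real_sum)
      also have "cmod \<dots> \<le> (\<Sum>i\<in>I. \<bar>a i\<bar> * (2 * (norm (z i) powr g * norm \<xi> powr g)))"
      proof (rule sum_norm_le)
        fix i
        have "cmod (iexp (z i \<bullet> \<xi>) - 1) \<le> 2 * (norm (z i) powr g * norm \<xi> powr g)"
        proof (cases "z i \<bullet> \<xi> = 0")
          case False
          have "cmod (iexp (z i \<bullet> \<xi>) - 1) \<le> 2 * \<bar>z i \<bullet> \<xi>\<bar> powr g"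
            by (rule cmod_iexp_minus_one_le[OF g(1,2) False])
          also have "\<dots> \<le> 2 * (norm (z i) * norm \<xi>) powr g"
            using g Cauchy_Schwarz_ineq2[of "z i" \<xi>] by (intro mult_left_mono powr_mono2) auto
          also have "\<dots> = 2 * (norm (z i) powr g * norm \<xi> powr g)" by (simp add: powr_mult)
          finally show ?thesis .
        qed simp
        thus "cmod (of_real (a i) * (iexp (z i \<bullet> \<xi>) - 1)) \<le> \<bar>a i\<bar> * (2 * (norm (z i) powr g * norm \<xi> powr g))"
          by (simp add: norm_mult mult_left_mono)
      qed
      also have "\<dots> = 2 * A * norm \<xi> powr g"
        unfolding A_def sum_distrib_left sum_distrib_right by (intro sum.cong refl) (simp only: mult_ac)
      finally show ?thesis .
    qed
    define D where "D = (\<lambda>\<xi>::'a. 4 * A\<^sup>2 * C * (1 + (norm \<xi>)\<^sup>2) powr (- (\<alpha> - g)))"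
    have "(2 * pi) ^ DIM('a) * kernel_form \<Phi> I z a \<le> (\<integral>\<xi>. D \<xi> \<partial>lborel)"
    proof (rule kernel_form_le_integral[OF I int cont B upper])
      show "integrable lborel D"
        using integrable_one_plus_norm_square_powr[of "\<alpha> - g", where 'a='a] g
        unfolding D_def by (intro integrable_mult_right) auto
      fix \<xi> :: 'a
      show "0 \<le> C * (1 + (norm \<xi>)\<^sup>2) powr - \<alpha>" using C by simp
      have pos: "1 + (norm \<xi>)\<^sup>2 > 0" by (simp add: add_pos_nonneg)
      have "(norm \<xi> powr g)\<^sup>2 = ((norm \<xi>)\<^sup>2) powr g"
        by (cases "\<xi> = 0") (simp_all add: power2_eq_square powr_mult)
      also have "\<dots> \<le> (1 + (norm \<xi>)\<^sup>2) powr g" using g by (intro powr_mono2) auto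
      finally have n: "(norm \<xi> powr g)\<^sup>2 \<le> (1 + (norm \<xi>)\<^sup>2) powr g" .
      have "(cmod (trig_sum I z a \<xi>))\<^sup>2 \<le> (2 * A * norm \<xi> powr g)\<^sup>2"
        using S by (intro power_mono) auto
      also have "\<dots> = 4 * A\<^sup>2 * (norm \<xi> powr g)\<^sup>2" by (simp add: power_mult_distrib)
      also have "\<dots> \<le> 4 * A\<^sup>2 * (1 + (norm \<xi>)\<^sup>2) powr g" using n by (intro mult_left_mono) auto
      finally have "(cmod (trig_sum I z a \<xi>))\<^sup>2 * (C * (1 + (norm \<xi>)\<^sup>2) powr - \<alpha>)
        \<le> (4 * A\<^sup>2 * (1 + (norm \<xi>)\<^sup>2) powr g) * (C * (1 + (norm \<xi>)\<^sup>2) powr - \<alpha>)"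
        using C by (intro mult_right_mono) auto
      also have "\<dots> = 4 * A\<^sup>2 * C * ((1 + (norm \<xi>)\<^sup>2) powr g * (1 + (norm \<xi>)\<^sup>2) powr - \<alpha>)"
        by (simp only: mult_ac)
      also have "\<dots> = D \<xi>" unfolding D_def powr_add[symmetric] by simp
      finally show "(cmod (trig_sum I z a \<xi>))\<^sup>2 * (C * (1 + (norm \<xi>)\<^sup>2) powr - \<alpha>) \<le> D \<xi>" .
    qed
    also have "\<dots> = 4 * A\<^sup>2 * C * W" by (simp add: D_def W_def)
    also have "\<dots> \<le> 4 * A\<^sup>2 * C * (W + 1)" using C by (intro mult_left_mono) auto
    finally show ?thesis unfolding A_def[symmetric] M_def by (simp add: field_simps)
  qed
  with M show ?thesis by blast
qed

section \<open>Coercivity of the form\<close>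

text \<open>The squared distances to the centres add up to a multiple of the squared distance to their
  centroid plus a constant.\<close>

lemma prod_gaussian_centroid:
  fixes c :: "'j \<Rightarrow> 'a::real_inner"
  assumes T: "finite T" "T \<noteq> {}"
  obtains k c' where "0 \<le> k" "k \<le> 1"
    "\<And>v. (\<Prod>j\<in>T. gaussian 1 (v - c j)) = k * gaussian (real (card T)) (v - c')"
proof
  define n where "n = real (card T)"
  have n: "n > 0" using T by (simp add: n_def card_gt_0_iff)
  define c' where "c' = (\<Sum>j\<in>T. c j) /\<^sub>R n"
  define k where "k = exp (- (\<Sum>j\<in>T. (norm (c j - c'))\<^sup>2))"
  show "0 \<le> k" "k \<le> 1" by (simp_all add: k_def sum_nonneg)
  fix v
  have "(norm (v - c j))\<^sup>2 = (norm (v - c'))\<^sup>2 + (norm (c j - c'))\<^sup>2 - 2 * ((v - c') \<bullet> (c j - c'))" for j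
    by (simp add: power2_norm_eq_inner inner_diff inner_commute algebra_simps)
  hence "(\<Sum>j\<in>T. (norm (v - c j))\<^sup>2)
      = n * (norm (v - c'))\<^sup>2 + (\<Sum>j\<in>T. (norm (c j - c'))\<^sup>2) - 2 * ((v - c') \<bullet> (\<Sum>j\<in>T. c j - c'))"
    by (simp only: sum.distrib sum_subtractf sum_distrib_left[symmetric] inner_sum_right[symmetric])
       (simp add: n_def)
  also have "(\<Sum>j\<in>T. c j - c') = 0"
    using n by (simp add: sum_subtractf sum_constant_scaleR c'_def n_def)
  finally show "(\<Prod>j\<in>T. gaussian 1 (v - c j)) = k * gaussian (real (card T)) (v - c')"
    using T by (simp add: gaussian_def exp_sum[symmetric] sum_negf k_def exp_add[symmetric] n_def)
qed

text \<open>By the centroid formula a product of Gaussians over \<open>T\<close> is again a Gaussian, of exponent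
  \<open>card T\<close>. Only finitely many exponents occur, so a single constant serves for all centres.\<close>

lemma gaussian_product_sum_le:
  fixes \<Phi> :: "'a::euclidean_space \<Rightarrow> real"
  assumes gauss: "\<And>r. r > 0 \<Longrightarrow> \<exists>M. \<forall>z a c. (\<Sum>i\<in>I. a i * gaussian r (z i - c))\<^sup>2 \<le> M * kernel_form \<Phi> I z a"
  shows "\<exists>M\<ge>0. \<forall>z a c (T::'j set). finite T \<longrightarrow> T \<noteq> {} \<longrightarrow> card T \<le> N \<longrightarrow>
     \<bar>\<Sum>i\<in>I. a i * (\<Prod>j\<in>T. gaussian 1 (z i - c j))\<bar> \<le> M * sqrt \<bar>kernel_form \<Phi> I z a\<bar>"
proof -
  have "\<forall>n. \<exists>M. n > 0 \<longrightarrow> (\<forall>z a c. (\<Sum>i\<in>I. a i * gaussian (real n) (z i - c))\<^sup>2 \<le> M * kernel_form \<Phi> I z a)"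
    using gauss by (metis of_nat_0_less_iff)
  then obtain m where m: "\<And>n z a c. n > 0 \<Longrightarrow>
      (\<Sum>i\<in>I. a i * gaussian (real n) (z i - c))\<^sup>2 \<le> m n * kernel_form \<Phi> I z a"
    by metis
  define M where "M = (\<Sum>n\<le>N. \<bar>m n\<bar>)"
  have M0: "M \<ge> 0" by (simp add: M_def)
  have "\<bar>\<Sum>i\<in>I. a i * (\<Prod>j\<in>T. gaussian 1 (z i - c j))\<bar> \<le> sqrt M * sqrt \<bar>kernel_form \<Phi> I z a\<bar>"
    if T: "finite T" "T \<noteq> {}" "card T \<le> N" for z a c and T :: "'j set"
  proof -
    obtain k c' where k: "0 \<le> k" "k \<le> 1"
      and eq: "\<And>v. (\<Prod>j\<in>T. gaussian 1 (v - c j)) = k * gaussian (real (card T)) (v - c')"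
      using prod_gaussian_centroid[OF T(1,2)] by blast
    define s where "s = (\<Sum>i\<in>I. a i * gaussian (real (card T)) (z i - c'))"
    have "(\<Sum>i\<in>I. a i * (\<Prod>j\<in>T. gaussian 1 (z i - c j))) = k * s"
      by (simp add: eq s_def sum_distrib_left mult_ac)
    hence "\<bar>\<Sum>i\<in>I. a i * (\<Prod>j\<in>T. gaussian 1 (z i - c j))\<bar> \<le> 1 * \<bar>s\<bar>"
      using k by (simp add: abs_mult mult_left_le_one_le)
    hence le: "\<bar>\<Sum>i\<in>I. a i * (\<Prod>j\<in>T. gaussian 1 (z i - c j))\<bar> \<le> \<bar>s\<bar>" by simp
    have "s\<^sup>2 \<le> m (card T) * kernel_form \<Phi> I z a"
      unfolding s_def using T by (intro m) (simp add: card_gt_0_iff)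
    also have "\<dots> \<le> \<bar>m (card T)\<bar> * \<bar>kernel_form \<Phi> I z a\<bar>" by (simp add: abs_mult[symmetric])
    also have "\<dots> \<le> M * \<bar>kernel_form \<Phi> I z a\<bar>"
      unfolding M_def using T by (intro mult_right_mono member_le_sum) auto
    finally have "\<bar>s\<bar> \<le> sqrt M * sqrt \<bar>kernel_form \<Phi> I z a\<bar>" 
      by (simp add: real_le_rsqrt real_sqrt_mult[symmetric] flip: real_sqrt_abs)
    with le show ?thesis by simp
  qed
  thus ?thesis using M0 by (intro exI[of _ "sqrt M"]) auto
qed

text \<open>Expanding the factors \<open>1 - e j\<close> one at a time leaves only products over non-empty sets, as \<open>T\<close>
  is non-empty.\<close>

lemma inclusion_exclusion_bound:
  fixes e :: "'j \<Rightarrow> 'i \<Rightarrow> real"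
  assumes B: "\<And>T. T \<subseteq> J \<Longrightarrow> T \<noteq> {} \<Longrightarrow> \<bar>\<Sum>i\<in>I. a i * (\<Prod>j\<in>T. e j i)\<bar> \<le> B"
    and J: "finite J" and S: "S \<subseteq> J" and T: "T \<subseteq> J" "T \<noteq> {}" "T \<inter> S = {}"
  shows "\<bar>\<Sum>i\<in>I. a i * ((\<Prod>j\<in>T. e j i) * (\<Prod>j\<in>S. 1 - e j i))\<bar> \<le> 2 ^ card S * B"
proof -
  have "finite S" using J S by (rule rev_finite_subset)
  thus ?thesis using S T
  proof (induction S arbitrary: T)
    case empty
    thus ?case using B by simp
  next
    case (insert s S)
    have "finite T" using J insert.prems by (meson rev_finite_subset)
    moreover have "s \<notin> T" using insert.prems by auto
    ultimately have "(\<Sum>i\<in>I. a i * ((\<Prod>j\<in>T. e j i) * (\<Prod>j\<in>insert s S. 1 - e j i)))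
        = (\<Sum>i\<in>I. a i * ((\<Prod>j\<in>T. e j i) * (\<Prod>j\<in>S. 1 - e j i)))
          - (\<Sum>i\<in>I. a i * ((\<Prod>j\<in>insert s T. e j i) * (\<Prod>j\<in>S. 1 - e j i)))"
      using insert.hyps by (simp add: sum_subtractf[symmetric] algebra_simps)
    also have "\<bar>\<dots>\<bar> \<le> 2 ^ card S * B + 2 ^ card S * B"
    proof (intro order.trans[OF abs_triangle_ineq4] add_mono)
      show "\<bar>\<Sum>i\<in>I. a i * ((\<Prod>j\<in>T. e j i) * (\<Prod>j\<in>S. 1 - e j i))\<bar> \<le> 2 ^ card S * B"
        by (rule insert.IH) (use insert.prems in auto)
      show "\<bar>\<Sum>i\<in>I. a i * ((\<Prod>j\<in>insert s T. e j i) * (\<Prod>j\<in>S. 1 - e j i))\<bar> \<le> 2 ^ card S * B"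
        by (rule insert.IH) (use insert.prems insert.hyps in auto)
    qed
    finally show ?case using insert.hyps by (simp add: mult_ac)
  qed
qed

text \<open>Here the constant term of the expansion cancels.\<close>

lemma inclusion_exclusion_one_bound:
  fixes e :: "'j \<Rightarrow> 'i \<Rightarrow> real"
  assumes B: "\<And>T. T \<subseteq> J \<Longrightarrow> T \<noteq> {} \<Longrightarrow> \<bar>\<Sum>i\<in>I. a i * (\<Prod>j\<in>T. e j i)\<bar> \<le> B"
    and J: "finite J" and S: "S \<subseteq> J" and B0: "B \<ge> 0"
  shows "\<bar>\<Sum>i\<in>I. a i * (1 - (\<Prod>j\<in>S. 1 - e j i))\<bar> \<le> 2 ^ card S * B"
proof -
  have "finite S" using J S by (rule rev_finite_subset)
  thus ?thesis using S
  proof (induction S)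
    case empty
    thus ?case using B0 by simp
  next
    case (insert s S)
    have "(\<Sum>i\<in>I. a i * (1 - (\<Prod>j\<in>insert s S. 1 - e j i)))
        = (\<Sum>i\<in>I. a i * (1 - (\<Prod>j\<in>S. 1 - e j i)))
          + (\<Sum>i\<in>I. a i * ((\<Prod>j\<in>{s}. e j i) * (\<Prod>j\<in>S. 1 - e j i)))"
      using insert.hyps by (simp add: sum.distrib[symmetric] algebra_simps)
    also have "\<bar>\<dots>\<bar> \<le> 2 ^ card S * B + 2 ^ card S * B"
    proof (intro order.trans[OF abs_triangle_ineq] add_mono)
      show "\<bar>\<Sum>i\<in>I. a i * (1 - (\<Prod>j\<in>S. 1 - e j i))\<bar> \<le> 2 ^ card S * B"
        by (rule insert.IH) (use insert.prems in auto)
      show "\<bar>\<Sum>i\<in>I. a i * ((\<Prod>j\<in>{s}. e j i) * (\<Prod>j\<in>S. 1 - e j i))\<bar> \<le> 2 ^ card S * B"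
        by (rule inclusion_exclusion_bound[OF B J]) (use insert.prems insert.hyps in auto)
    qed
    finally show ?case using insert.hyps by (simp add: mult_ac)
  qed
qed

text \<open>The products of Gaussians yield two kinds of test functions on the points \<open>z\<close>. Since every point
  is one of the centres, \<open>1 - (\<Prod>j. 1 - gaussian 1 (v - z j))\<close> equals \<open>1\<close> at all of them, which recovers
  the sum of the coefficients; and
  \<open>gaussian 1 (v - z k) * (\<Prod>j\<noteq>k. 1 - gaussian 1 (v - z j))\<close> vanishes at all points except \<open>z k\<close>, which
  recovers a single coefficient. The essential point is that \<open>M\<close> does not depend on the points.\<close>

lemma kernel_form_coercive:
  fixes \<Phi> :: "'a::euclidean_space \<Rightarrow> real"
  assumes I: "finite (I :: 'i set)"
    and gauss: "\<And>r. r > 0 \<Longrightarrow> \<exists>M. \<forall>z a c. (\<Sum>i\<in>I. a i * gaussian r (z i - c))\<^sup>2 \<le> M * kernel_form \<Phi> I z a"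
  shows "\<exists>M>0. \<forall>z a. \<bar>\<Sum>i\<in>I. a i\<bar> \<le> M * sqrt \<bar>kernel_form \<Phi> I z a\<bar> \<and>
     (\<forall>k\<in>I. \<bar>a k\<bar> * (\<Prod>j\<in>I - {k}. 1 - gaussian 1 (z k - z j)) \<le> M * sqrt \<bar>kernel_form \<Phi> I z a\<bar>)"
proof -
  obtain M where M: "M \<ge> 0" and prod: "\<And>z a c (T::'i set). finite T \<Longrightarrow> T \<noteq> {} \<Longrightarrow> card T \<le> card I \<Longrightarrow>
     \<bar>\<Sum>i\<in>I. a i * (\<Prod>j\<in>T. gaussian 1 (z i - c j))\<bar> \<le> M * sqrt \<bar>kernel_form \<Phi> I z a\<bar>"
    using gaussian_product_sum_le[OF gauss, where N="card I"] by blast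
  have g0: "gaussian 1 (0::'a) = 1" by (simp add: gaussian_def)
  have bound: "\<bar>\<Sum>i\<in>I. a i\<bar> \<le> 2 ^ card I * M * sqrt \<bar>kernel_form \<Phi> I z a\<bar> \<and>
     (\<forall>k\<in>I. \<bar>a k\<bar> * (\<Prod>j\<in>I - {k}. 1 - gaussian 1 (z k - z j)) \<le> 2 ^ card I * M * sqrt \<bar>kernel_form \<Phi> I z a\<bar>)"
    for z a
  proof (intro conjI ballI)
    define B where "B = M * sqrt \<bar>kernel_form \<Phi> I z a\<bar>"
    have B0: "B \<ge> 0" using M by (simp add: B_def)
    define e where "e = (\<lambda>j i. gaussian 1 (z i - z j))"
    have eB: "\<bar>\<Sum>i\<in>I. a i * (\<Prod>j\<in>T. e j i)\<bar> \<le> B" if "T \<subseteq> I" "T \<noteq> {}" for T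
      unfolding B_def e_def using that I by (intro prod card_mono) (auto intro: finite_subset)
    have vanish: "(\<Prod>j\<in>S. 1 - e j i) = 0" if "i \<in> S" "S \<subseteq> I" for S i
      using that I finite_subset[OF that(2) I] by (intro prod_zero bexI[of _ i]) (auto simp: e_def g0)
    have "(\<Sum>i\<in>I. a i) = (\<Sum>i\<in>I. a i * (1 - (\<Prod>j\<in>I. 1 - e j i)))"
      using vanish by (intro sum.cong) auto
    thus "\<bar>\<Sum>i\<in>I. a i\<bar> \<le> 2 ^ card I * M * sqrt \<bar>kernel_form \<Phi> I z a\<bar>"
      using inclusion_exclusion_one_bound[OF eB I subset_refl B0] by (simp add: B_def mult.assoc)
    fix k assume k: "k \<in> I"
    have "(\<Sum>i\<in>I. a i * ((\<Prod>j\<in>{k}. e j i) * (\<Prod>j\<in>I - {k}. 1 - e j i)))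
        = (\<Sum>i\<in>I. if i = k then a k * (\<Prod>j\<in>I - {k}. 1 - e j k) else 0)"
      using vanish[of _ "I - {k}"] by (intro sum.cong) (auto simp: e_def g0)
    also have "\<dots> = a k * (\<Prod>j\<in>I - {k}. 1 - e j k)" using k I by simp
    finally have "\<bar>a k * (\<Prod>j\<in>I - {k}. 1 - e j k)\<bar> \<le> 2 ^ card (I - {k}) * B"
      using inclusion_exclusion_bound[OF eB I, of "I - {k}" "{k}"] k by auto
    also have "\<dots> \<le> 2 ^ card I * B"
      using B0 I by (intro mult_right_mono power_increasing card_mono) auto
    also have "\<bar>a k * (\<Prod>j\<in>I - {k}. 1 - e j k)\<bar> = \<bar>a k\<bar> * (\<Prod>j\<in>I - {k}. 1 - gaussian 1 (z k - z j))"
      by (simp add: abs_mult abs_prod e_def gaussian_le_1)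
    finally show "\<bar>a k\<bar> * (\<Prod>j\<in>I - {k}. 1 - gaussian 1 (z k - z j)) \<le> 2 ^ card I * M * sqrt \<bar>kernel_form \<Phi> I z a\<bar>"
      by (simp add: B_def mult.assoc)
  qed
  have "2 ^ card I * M * sqrt \<bar>kernel_form \<Phi> I z a\<bar> \<le> (2 ^ card I * M + 1) * sqrt \<bar>kernel_form \<Phi> I z a\<bar>" for z a
    by (intro mult_right_mono) auto
  moreover have "2 ^ card I * M + 1 > 0" using M by (simp add: add_nonneg_pos)
  ultimately show ?thesis using bound by (intro exI[of _ "2 ^ card I * M + 1"]) (meson order.trans)
qed

section \<open>Determinants and inverses of coercive matrices\<close>

lemma invertible_matrix_inv_right:
  fixes A :: "real ^ 'n ^ 'n"
  assumes "invertible A"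
  shows "A ** matrix_inv A = mat 1"
  unfolding matrix_inv_def by (rule conjunct1[OF someI_ex[OF assms[unfolded invertible_def]]])

lemma coercive_invertible:
  fixes A :: "real ^ 'n ^ 'n"
  assumes "\<mu> > 0" "\<And>v. \<mu> * (v \<bullet> v) \<le> v \<bullet> (A *v v)"
  shows "invertible A"
proof -
  have "v = 0" if "A *v v = 0" for v
  proof -
    have "\<mu> * (v \<bullet> v) \<le> 0" using assms(2)[of v] that by simp
    hence "v \<bullet> v \<le> 0" using assms(1) by (simp add: mult_le_0_iff)
    hence "v \<bullet> v = 0" using inner_ge_zero[of v] by linarith
    thus "v = 0" by simp
  qed
  thus ?thesis by (simp add: invertible_left_inverse matrix_left_invertible_ker)
qed

text \<open>The determinant does not vanish on the segment from the identity to \<open>A\<close>, which consists of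
  coercive matrices.\<close>

lemma coercive_det_pos:
  fixes A :: "real ^ 'n ^ 'n"
  assumes \<mu>: "\<mu> > 0" and A: "\<And>v. \<mu> * (v \<bullet> v) \<le> v \<bullet> (A *v v)"
  shows "det A > 0"
proof (rule ccontr)
  assume neg: "\<not> det A > 0"
  define P where "P = (\<lambda>t. t *\<^sub>R A + (1 - t) *\<^sub>R mat 1)"
  have P01: "P 0 = mat 1" "P 1 = A" by (simp_all add: P_def)
  have Pv: "P t *v v = t *\<^sub>R (A *v v) + (1 - t) *\<^sub>R v" for t v
    by (simp only: P_def matrix_vector_mult_add_rdistrib scaleR_matrix_vector_assoc[symmetric]
        matrix_vector_mul_lid)
  have "continuous_on {0..1} (\<lambda>t. det (P t))"
    unfolding det_def P_def vector_add_component vector_scaleR_component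
    by (intro continuous_intros)
  hence "\<exists>t\<ge>0. t \<le> 1 \<and> det (P t) = 0"
    using neg P01 by (intro IVT2') (auto simp: det_I)
  then obtain t where t: "0 \<le> t" "t \<le> 1" "det (P t) = 0" by blast
  have "t * \<mu> + (1 - t) > 0"
    using t \<mu> by (cases "t = 1") (auto intro: add_nonneg_pos)
  moreover have "(t * \<mu> + (1 - t)) * (v \<bullet> v) \<le> v \<bullet> (P t *v v)" for v
    using mult_left_mono[OF A[of v] t(1)] by (simp add: Pv inner_add_right algebra_simps)
  ultimately have "invertible (P t)" by (rule coercive_invertible)
  with t show False by (simp add: invertible_det_nz)
qed

lemma abs_det_le:
  fixes A :: "real ^ 'n ^ 'n"
  assumes "\<And>i j. \<bar>A $ i $ j\<bar> \<le> B"
  shows "\<bar>det A\<bar> \<le> fact CARD('n) * B ^ CARD('n)"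
proof -
  have "\<bar>det A\<bar> \<le> (\<Sum>p | p permutes (UNIV :: 'n set). \<bar>of_int (sign p) * (\<Prod>i\<in>UNIV. A $ i $ p i)\<bar>)"
    unfolding det_def by (rule sum_abs)
  also have "\<dots> \<le> (\<Sum>p | p permutes (UNIV :: 'n set). B ^ CARD('n))"
  proof (rule sum_mono)
    fix p :: "'n \<Rightarrow> 'n"
    have "\<bar>of_int (sign p) * (\<Prod>i\<in>UNIV. A $ i $ p i)\<bar> = (\<Prod>i\<in>UNIV. \<bar>A $ i $ p i\<bar>)"
      by (simp add: abs_mult abs_prod sign_def)
    also have "\<dots> \<le> (\<Prod>i\<in>(UNIV::'n set). B)" using assms by (intro prod_mono) auto
    finally show "\<bar>of_int (sign p) * (\<Prod>i\<in>UNIV. A $ i $ p i)\<bar> \<le> B ^ CARD('n)" by simp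
  qed
  also have "\<dots> = fact CARD('n) * B ^ CARD('n)"
    by (simp add: card_permutations)
  finally show ?thesis .
qed

text \<open>The entries of the inverse are at most \<open>1 / \<mu>\<close>, so the Leibniz formula bounds the determinant of
  the inverse from above. The constant \<open>1 / n!\<close> is far from optimal, but it avoids eigenvalues and
  is harmless after taking logarithms.\<close>

lemma coercive_det_ge:
  fixes A :: "real ^ 'n ^ 'n"
  assumes \<mu>: "\<mu> > 0" and A: "\<And>v. \<mu> * (v \<bullet> v) \<le> v \<bullet> (A *v v)"
  shows "\<mu> ^ CARD('n) / fact CARD('n) \<le> det A"
proof -
  define B where "B = matrix_inv A"
  have AB: "A ** B = mat 1"
    unfolding B_def by (rule invertible_matrix_inv_right[OF coercive_invertible[OF assms]])
  have "\<bar>B $ i $ j\<bar> \<le> 1 / \<mu>" for i j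
  proof -
    define b where "b = B *v axis j 1"
    have Ab: "A *v b = axis j 1" by (simp add: b_def matrix_vector_mul_assoc AB)
    have "\<mu> * (norm b * norm b) \<le> b \<bullet> axis j 1"
      using A[of b] by (simp add: Ab power2_norm_eq_inner[symmetric] power2_eq_square)
    also have "\<dots> \<le> norm b * 1"
      using norm_cauchy_schwarz[of b "axis j 1"] by (simp add: norm_axis_1)
    finally have "\<mu> * norm b * norm b \<le> 1 * norm b" by simp
    hence "norm b \<le> 1 / \<mu>"
      using \<mu> by (cases "norm b = 0") (simp_all add: pos_le_divide_eq mult.commute)
    moreover have "B $ i $ j = b $ i" by (simp add: b_def matrix_vector_mult_basis column_def)
    ultimately show ?thesis using component_le_norm_cart[of b i] by simp
  qed
  hence "\<bar>det B\<bar> \<le> fact CARD('n) * (1 / \<mu>) ^ CARD('n)" by (rule abs_det_le)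
  hence "det A * det B \<le> det A * (fact CARD('n) * (1 / \<mu>) ^ CARD('n))"
    using coercive_det_pos[OF assms] by (intro mult_left_mono) auto
  also have "det A * det B = 1" using det_mul[of A B] AB by (simp add: det_I)
  finally show ?thesis using \<mu> by (simp add: field_simps)
qed

text \<open>For \<open>b = A\<^sup>-\<^sup>1 (c, \<dots>, c)\<close> the form \<open>q = b \<bullet> A b\<close> equals \<open>c\<close> times the sum of the entries of
  \<open>b\<close>, so the hypothesis bounds \<open>q\<^sup>2\<close> by \<open>c\<^sup>2 M q\<close>.\<close>

lemma inverse_form_le:
  fixes A :: "real ^ 'n ^ 'n"
  assumes inv: "invertible A" and M: "\<And>v. (\<Sum>i\<in>UNIV. v $ i)\<^sup>2 \<le> M * (v \<bullet> (A *v v))" "M > 0"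
  shows "(\<chi> i. c) \<bullet> (matrix_inv A *v (\<chi> i. c)) \<le> c\<^sup>2 * M"
proof -
  define b where "b = matrix_inv A *v (\<chi> i. c)"
  define q where "q = (\<chi> i. c) \<bullet> b"
  have Ab: "A *v b = (\<chi> i. c)"
    by (simp add: b_def matrix_vector_mul_assoc invertible_matrix_inv_right[OF inv])
  have q: "q = c * (\<Sum>i\<in>UNIV. b $ i)"
    by (simp add: q_def inner_vec_def sum_distrib_left)
  have le: "(\<Sum>i\<in>UNIV. b $ i)\<^sup>2 \<le> M * q" using M(1)[of b] by (simp add: Ab q_def inner_commute)
  have "q * q = c\<^sup>2 * (\<Sum>i\<in>UNIV. b $ i)\<^sup>2" by (simp add: q power2_eq_square)
  also have "\<dots> \<le> c\<^sup>2 * (M * q)" using le by (intro mult_left_mono) auto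
  finally have "q * q \<le> c\<^sup>2 * M * q" by simp
  moreover have "0 \<le> q"
  proof -
    have "0 \<le> M * q" using le by (meson order.trans zero_le_power2)
    thus ?thesis using M(2) by (simp add: zero_le_mult_iff)
  qed
  ultimately have "q \<le> c\<^sup>2 * M"
    using M(2) by (cases "q = 0") auto
  thus ?thesis by (simp add: q_def b_def)
qed

text \<open>One half of the duality \<open>Y \<bullet> A\<^sup>-\<^sup>1 Y = sup\<^sub>a (a \<bullet> Y)\<^sup>2 / (a \<bullet> A a)\<close>.\<close>

lemma inverse_form_ge:
  fixes A :: "real ^ 'n ^ 'n"
  assumes inv: "invertible A" and sym: "transpose A = A"
    and nonneg: "\<And>v. 0 \<le> v \<bullet> (A *v v)" and pos: "a \<bullet> (A *v a) > 0"
  shows "(a \<bullet> Y)\<^sup>2 / (a \<bullet> (A *v a)) \<le> Y \<bullet> (matrix_inv A *v Y)"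
proof -
  define b where "b = matrix_inv A *v Y"
  have Ab: "A *v b = Y"
    by (simp add: b_def matrix_vector_mul_assoc invertible_matrix_inv_right[OF inv])
  have comm: "b \<bullet> (A *v a) = a \<bullet> Y"
  proof -
    have "b v* A = Y" using transpose_matrix_vector[of A b] sym Ab by simp
    thus ?thesis using dot_lmul_matrix[of b A a] by (simp add: inner_commute)
  qed
  define q t where "q = a \<bullet> (A *v a)" and "t = (a \<bullet> Y) / q"
  \<comment> \<open>With this \<open>t\<close>, \<open>t *\<^sub>R a\<close> is the projection of \<open>b\<close> onto the line of \<open>a\<close> with respect to \<open>A\<close>.\<close>
  have "0 \<le> (b - t *\<^sub>R a) \<bullet> (A *v (b - t *\<^sub>R a))" by (rule nonneg)
  also have "\<dots> = Y \<bullet> b - 2 * t * (a \<bullet> Y) + t * (t * q)"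
    by (simp add: matrix_vector_mult_diff_distrib matrix_vector_mult_scaleR Ab inner_diff comm q_def
        inner_commute[of b Y] algebra_simps)
  also have "t * q = a \<bullet> Y" using pos by (simp add: t_def q_def)
  finally have "t * (a \<bullet> Y) \<le> Y \<bullet> b" by simp
  thus ?thesis by (simp add: t_def q_def b_def power2_eq_square)
qed

section \<open>Kernel matrices under rescaling\<close>

lemma kernel_matrix_form:
  "v \<bullet> (kernel_matrix (scaled_kernel \<Phi> lam) x *v v)
     = kernel_form \<Phi> UNIV (\<lambda>i. x i /\<^sub>R lam) (\<lambda>i. v $ i)"
  by (simp add: inner_vec_def matrix_vector_mult_def kernel_matrix_def scaled_kernel_def
      kernel_form_def sum_distrib_left scaleR_diff_right mult_ac)

lemma one_minus_exp_ge:
  fixes r :: real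
  assumes "0 < d" "0 < l" "d / l \<le> r"
  shows "d / (l + d) \<le> 1 - exp (- r)"
proof -
  have "1 + d / l \<le> exp r" using exp_ge_add_one_self[of r] assms by linarith
  hence "exp (- r) \<le> inverse (1 + d / l)"
    unfolding exp_minus using assms by (intro le_imp_inverse_le) (auto intro: add_pos_pos)
  thus ?thesis using assms by (simp add: field_simps)
qed

text \<open>At the points \<open>x i / lam\<close> each factor \<open>1 - gaussian 1 (z k - z j)\<close> is at least
  \<open>d / (lam\<^sup>2 + d)\<close>, where \<open>d\<close> is a lower bound for the squared distances of the points. Thus the
  coercivity constant decays at most polynomially in \<open>lam\<close>, while the control of the sum of the
  entries is uniform in \<open>lam\<close>.\<close>

lemma kernel_matrix_coercive:
  fixes \<Phi> :: "'a::euclidean_space \<Rightarrow> real" and x :: "'n::finite \<Rightarrow> 'a"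
  assumes x: "inj x"
    and nonneg: "\<And>z a. 0 \<le> kernel_form \<Phi> (UNIV :: 'n set) z a"
    and gauss: "\<And>r. r > 0 \<Longrightarrow> \<exists>M. \<forall>z a c. (\<Sum>i\<in>(UNIV :: 'n set). a i * gaussian r (z i - c))\<^sup>2 \<le> M * kernel_form \<Phi> UNIV z a"
  obtains d c M where "d > 0" "c > 0" "M > 0"
    "\<And>lam v. lam > 0 \<Longrightarrow> c * (d / (lam\<^sup>2 + d)) ^ (2 * CARD('n)) * (v \<bullet> v)
        \<le> v \<bullet> (kernel_matrix (scaled_kernel \<Phi> lam) x *v v)"
    "\<And>lam v. (\<Sum>i\<in>UNIV. v $ i)\<^sup>2 \<le> M * (v \<bullet> (kernel_matrix (scaled_kernel \<Phi> lam) x *v v))"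
proof -
  obtain M where M: "M > 0"
    and H: "\<forall>z a. \<bar>\<Sum>i\<in>UNIV. a i\<bar> \<le> M * sqrt \<bar>kernel_form \<Phi> (UNIV :: 'n set) z a\<bar> \<and>
     (\<forall>k\<in>UNIV. \<bar>a k\<bar> * (\<Prod>j\<in>UNIV - {k}. 1 - gaussian 1 (z k - z j)) \<le> M * sqrt \<bar>kernel_form \<Phi> UNIV z a\<bar>)"
    using kernel_form_coercive[of "UNIV :: 'n set" \<Phi>, OF finite gauss] by blast
  have sum: "\<bar>\<Sum>i\<in>(UNIV :: 'n set). a i\<bar> \<le> M * sqrt \<bar>kernel_form \<Phi> UNIV z a\<bar>"
    for z a using H by simp
  have comp: "\<bar>a k\<bar> * (\<Prod>j\<in>UNIV - {k}. 1 - gaussian 1 (z k - z j))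
        \<le> M * sqrt \<bar>kernel_form \<Phi> (UNIV :: 'n set) z a\<bar>"
    for z a k using H by simp
  define D where "D = (\<lambda>(i, j). (norm (x i - x j))\<^sup>2) ` {(i, j). i \<noteq> j}"
  \<comment> \<open>The element \<open>1\<close> keeps the set non-empty when there is only one point.\<close>
  define d where "d = Min (insert 1 D)"
  have finD: "finite D" unfolding D_def by (intro finite_imageI) (rule finite)
  have d: "d > 0" unfolding d_def using finD x by (auto simp: D_def inj_eq)
  have d_le: "d \<le> (norm (x i - x j))\<^sup>2" if "i \<noteq> j" for i j
    unfolding d_def using finD that by (intro Min_le) (auto simp: D_def)
  let ?n = "CARD('n)"
  have sqrt_sq: "(M * sqrt \<bar>kernel_form \<Phi> UNIV z a\<bar>)\<^sup>2 = M\<^sup>2 * kernel_form \<Phi> UNIV z a"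
    for z and a :: "'n \<Rightarrow> real"
    using nonneg[of z a] by (simp add: power_mult_distrib)
  show ?thesis
  proof (rule that[of d "1 / (real ?n * M\<^sup>2)" "M\<^sup>2"])
    fix lam :: real and v :: "real ^ 'n"
    let ?Q = "v \<bullet> (kernel_matrix (scaled_kernel \<Phi> lam) x *v v)"
    show "(\<Sum>i\<in>UNIV. v $ i)\<^sup>2 \<le> M\<^sup>2 * ?Q"
      unfolding kernel_matrix_form sqrt_sq[symmetric]
      using power_mono[OF sum[of "\<lambda>i. v $ i"] abs_ge_zero, of 2] by simp
    assume lam: "lam > 0"
    define \<rho> where "\<rho> = d / (lam\<^sup>2 + d)"
    have \<rho>: "0 < \<rho>" "\<rho> \<le> 1" using d lam by (auto simp: \<rho>_def add_nonneg_pos)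
    have k: "\<rho> ^ (2 * ?n) * (v $ k)\<^sup>2 \<le> M\<^sup>2 * ?Q" for k
    proof -
      have fac: "\<rho> \<le> 1 - gaussian 1 (x k /\<^sub>R lam - x j /\<^sub>R lam)" if "j \<noteq> k" for j
      proof -
        have "norm (x k /\<^sub>R lam - x j /\<^sub>R lam) = norm (x k - x j) / lam"
          using lam by (simp add: scaleR_diff_right[symmetric] divide_inverse mult.commute)
        moreover have "d / lam\<^sup>2 \<le> (norm (x k - x j))\<^sup>2 / lam\<^sup>2"
          using d_le[of k j] that by (intro divide_right_mono) auto
        ultimately show ?thesis
          unfolding gaussian_def \<rho>_def using d lam
          by (intro one_minus_exp_ge) (simp_all add: power_divide)
      qed
      have "\<rho> ^ ?n \<le> \<rho> ^ card (UNIV - {k})"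
        using \<rho> by (intro power_decreasing card_mono) auto
      also have "\<dots> = (\<Prod>j\<in>UNIV - {k}. \<rho>)" by simp
      also have "\<dots> \<le> (\<Prod>j\<in>UNIV - {k}. 1 - gaussian 1 (x k /\<^sub>R lam - x j /\<^sub>R lam))"
        using \<rho> fac by (intro prod_mono) auto
      finally have "\<bar>v $ k\<bar> * \<rho> ^ ?n \<le> \<bar>v $ k\<bar> * \<dots>" by (intro mult_left_mono) auto
      also have "\<dots> \<le> M * sqrt \<bar>kernel_form \<Phi> UNIV (\<lambda>i. x i /\<^sub>R lam) (\<lambda>i. v $ i)\<bar>"
        by (rule comp)
      finally have "(\<bar>v $ k\<bar> * \<rho> ^ ?n)\<^sup>2 \<le> M\<^sup>2 * ?Q"
        unfolding kernel_matrix_form sqrt_sq[symmetric] using \<rho> by (intro power_mono) auto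
      thus ?thesis by (simp add: power_mult_distrib power_mult[symmetric] mult_ac)
    qed
    have "\<rho> ^ (2 * ?n) * (v \<bullet> v) = (\<Sum>k\<in>UNIV. \<rho> ^ (2 * ?n) * (v $ k)\<^sup>2)"
      by (simp add: inner_vec_def sum_distrib_left power2_eq_square)
    also have "\<dots> \<le> real ?n * (M\<^sup>2 * ?Q)"
      using sum_mono[of UNIV, OF k] by simp
    finally show "1 / (real ?n * M\<^sup>2) * (d / (lam\<^sup>2 + d)) ^ (2 * ?n) * (v \<bullet> v) \<le> ?Q"
      unfolding \<rho>_def[symmetric] using M by (simp add: pos_divide_le_eq mult_ac)
  qed (use d M in simp_all)
qed

section \<open>Minimising sequences\<close>

text \<open>The infimum is \<open>-\<infinity>\<close>, and a minimising sequence cannot return to a bounded set of scales, where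
  the values are bounded below.\<close>

lemma argmin_infiniteI:
  assumes lim: "filterlim f at_bot at_top"
    and below: "\<And>L. \<exists>b. \<forall>lam. 0 < lam \<longrightarrow> lam \<le> L \<longrightarrow> b \<le> f lam"
  shows "argmin_infinite f"
  unfolding argmin_infinite_def
proof (intro allI impI)
  fix s assume s: "minimising_sequence f s"
  have inf: "(INF lam\<in>{0<..}. ereal (f lam)) = -\<infinity>"
  proof (rule ereal_bot)
    fix B :: real
    have "eventually (\<lambda>lam. f lam \<le> B \<and> lam > 0) at_top"
      using lim eventually_gt_at_top[of 0] unfolding filterlim_at_bot by (intro eventually_conj) blast+
    then obtain lam where "f lam \<le> B" "lam > 0"
      using eventually_happens'[OF trivial_limit_at_top_linorder] by blast
    thus "(INF lam\<in>{0<..}. ereal (f lam)) \<le> ereal B" by (intro INF_lower2[of lam]) auto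
  qed
  show "filterlim s at_top sequentially"
    unfolding filterlim_at_top
  proof
    fix L
    obtain b where b: "\<And>lam. 0 < lam \<Longrightarrow> lam \<le> L \<Longrightarrow> b \<le> f lam" using below by blast
    have "(\<lambda>k. ereal (f (s k))) \<longlonglongrightarrow> -\<infinity>"
      using s by (simp add: minimising_sequence_def inf)
    hence "eventually (\<lambda>k. ereal (f (s k)) < ereal b) sequentially"
      by (rule order_tendstoD(2)) simp
    thus "eventually (\<lambda>k. L \<le> s k) sequentially"
    proof eventually_elim
      case (elim k)
      moreover have "s k > 0" using s by (simp add: minimising_sequence_def)
      ultimately show ?case using b[of "s k"] by force
    qed
  qed
qed

text \<open>The infimum is at most \<open>f 1\<close>, whereas all large scales have values of at least \<open>f 1 + 1\<close>.\<close>

lemma argmin_finiteI: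
  assumes lim: "filterlim f at_top at_top"
  shows "argmin_finite f"
  unfolding argmin_finite_def
proof (intro allI impI)
  fix s assume s: "minimising_sequence f s"
  have "eventually (\<lambda>lam. f lam \<ge> f 1 + 1) at_top"
    using lim by (auto simp: filterlim_at_top)
  then obtain L where L: "\<And>lam. lam \<ge> L \<Longrightarrow> f lam \<ge> f 1 + 1"
    by (auto simp: eventually_at_top_linorder)
  have "(INF lam\<in>{0<..}. ereal (f lam)) \<le> ereal (f 1)" by (rule INF_lower) simp
  also have "\<dots> < ereal (f 1 + 1)" by simp
  finally have inf: "(INF lam\<in>{0<..}. ereal (f lam)) < ereal (f 1 + 1)" .
  have "(\<lambda>k. ereal (f (s k))) \<longlonglongrightarrow> (INF lam\<in>{0<..}. ereal (f lam))"
    using s by (simp add: minimising_sequence_def)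
  from order_tendstoD(2)[OF this inf]
  have "eventually (\<lambda>k. ereal (f (s k)) < ereal (f 1 + 1)) sequentially" .
  hence "eventually (\<lambda>k. norm (s k) \<le> L) sequentially"
  proof eventually_elim
    case (elim k)
    moreover have "s k > 0" using s by (simp add: minimising_sequence_def)
    ultimately show ?case using L[of "s k"] by force
  qed
  hence "Bseq s" by (rule BfunI)
  thus "bounded (range s)" by (simp add: Bseq_eq_bounded)
qed

section \<open>The limit of the likelihood loss\<close>

text \<open>Positivity of the form for the points \<open>0, u\<close> with coefficients \<open>1, \<plusminus>1\<close>.\<close>

lemma positive_definite_even_bounded:
  fixes \<Phi> :: "'a::real_vector \<Rightarrow> real"
  assumes "positive_definite_kernel (\<lambda>u v. \<Phi> (u - v))"
  shows "\<Phi> (- u) = \<Phi> u" and "\<bar>\<Phi> u\<bar> \<le> \<bar>\<Phi> 0\<bar>"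
proof -
  have "\<Phi> (0 - u) = \<Phi> (u - 0)"
    using assms unfolding positive_definite_kernel_def by blast
  thus even: "\<Phi> (- u) = \<Phi> u" by simp
  show "\<bar>\<Phi> u\<bar> \<le> \<bar>\<Phi> 0\<bar>"
  proof (cases "u = 0")
    case False
    define z where "z = (\<lambda>i::nat. if i = 0 then 0 else u)"
    have inj: "inj_on z {..<2}" using False by (auto simp: inj_on_def z_def)
    have pos: "0 < (\<Sum>i<2. \<Sum>j<2. a i * a j * \<Phi> (z i - z j))" if a: "a 0 \<noteq> 0" for a
    proof -
      have "\<exists>i<2::nat. a i \<noteq> 0" using a by (intro exI[of _ 0]) simp
      with inj assms show ?thesis unfolding positive_definite_kernel_def by blast
    qed
    from pos[of "\<lambda>i. 1"] pos[of "\<lambda>i. if i = 0 then 1 else - 1"]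
    show ?thesis by (simp add: numeral_2_eq_2 z_def even)
  qed simp
qed

theorem theorem2p3:
  fixes x :: "'n::finite \<Rightarrow> real ^ 'd::finite"
    and m :: "real ^ 'd \<Rightarrow> real"
    and Y :: "real ^ 'n"
    and K :: "real ^ 'd \<Rightarrow> real ^ 'd \<Rightarrow> real"
    and \<Phi> :: "real ^ 'd \<Rightarrow> real"
    and C1 C2 \<alpha> :: real
  assumes "CARD('n) \<ge> 2"
    and "inj x"
    and "\<And>u v. K u v = \<Phi> (u - v)"
    and "positive_definite_kernel K"
    and "continuous_on UNIV \<Phi>"
    and "integrable lborel \<Phi>"
    and "C1 > 0" and "C2 > 0"
    and "\<alpha> > real CARD('d) / 2"
    and "\<And>\<xi>. C1 * (1 + (norm \<xi>)\<^sup>2) powr (- \<alpha>) \<le> Re (fourier_transform \<Phi> \<xi>)"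
    and "\<And>\<xi>. Re (fourier_transform \<Phi> \<xi>) \<le> C2 * (1 + (norm \<xi>)\<^sup>2) powr (- \<alpha>)"
  shows "(m_constant m x Y \<longrightarrow>
            filterlim (likelihood_loss \<Phi> m x Y) at_bot at_top \<and>
            argmin_infinite (likelihood_loss \<Phi> m x Y)) \<and>
         (\<not> m_constant m x Y \<longrightarrow>
            filterlim (likelihood_loss \<Phi> m x Y) at_top at_top \<and>
            argmin_finite (likelihood_loss \<Phi> m x Y))"
proof -
  note cont = assms(5) and int = assms(6) and lower = assms(10) and upper = assms(11)
  have "K = (\<lambda>u v. \<Phi> (u - v))" using assms(3) by blast
  hence pd: "positive_definite_kernel (\<lambda>u v. \<Phi> (u - v))" using assms(4) by simp
  note even = positive_definite_even_bounded(1)[OF pd]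
    and B = positive_definite_even_bounded(2)[OF pd]
  have \<alpha>: "\<alpha> > 0" using assms(9) by (rule le_less_trans[rotated]) simp
  define A where "A = (\<lambda>lam. kernel_matrix (scaled_kernel \<Phi> lam) x)"
  define W where "W = centred m x Y"
  have loss: "likelihood_loss \<Phi> m x Y lam = W \<bullet> (matrix_inv (A lam) *v W) + ln (det (A lam))" for lam
    by (simp add: likelihood_loss_def A_def W_def)
  have form: "v \<bullet> (A lam *v v) = kernel_form \<Phi> UNIV (\<lambda>i. x i /\<^sub>R lam) (\<lambda>i. v $ i)" for lam v
    unfolding A_def by (rule kernel_matrix_form)

  have nonneg: "0 \<le> kernel_form \<Phi> (UNIV :: 'n set) z a" for z a
  proof (rule kernel_form_nonneg[OF finite int cont B])
    fix \<xi> :: "real ^ 'd"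
    have "0 \<le> C1 * (1 + (norm \<xi>)\<^sup>2) powr (- \<alpha>)" using assms(7) by simp
    thus "0 \<le> Re (fourier_transform \<Phi> \<xi>)" using lower by (rule order.trans)
  qed
  have gauss: "\<exists>M. \<forall>z a c. (\<Sum>i\<in>(UNIV :: 'n set). a i * gaussian r (z i - c))\<^sup>2 \<le> M * kernel_form \<Phi> UNIV z a"
    if "r > 0" for r
    using gaussian_sum_square_le[OF int cont B assms(7) \<alpha> lower that, where 'i='n] by (meson finite)
  obtain d c M where d: "d > 0" and c: "c > 0" and M: "M > 0"
    and coercive: "\<And>lam v. lam > 0 \<Longrightarrow> c * (d / (lam\<^sup>2 + d)) ^ (2 * CARD('n)) * (v \<bullet> v) \<le> v \<bullet> (A lam *v v)"
    and const: "\<And>lam v. (\<Sum>i\<in>UNIV. v $ i)\<^sup>2 \<le> M * (v \<bullet> (A lam *v v))"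
    unfolding A_def by (rule kernel_matrix_coercive[OF assms(2) nonneg gauss]) blast+
  define \<mu> where "\<mu> = (\<lambda>lam. c * (d / (lam\<^sup>2 + d)) ^ (2 * CARD('n)))"
  have \<mu>: "\<mu> lam > 0" if "lam > 0" for lam using c d that by (simp add: \<mu>_def add_nonneg_pos)
  have coer: "\<mu> lam * (v \<bullet> v) \<le> v \<bullet> (A lam *v v)" if "lam > 0" for lam v
    unfolding \<mu>_def using that by (rule coercive)
  have inv: "invertible (A lam)" and det_pos: "det (A lam) > 0" if "lam > 0" for lam
    using coercive_invertible[OF \<mu> coer] coercive_det_pos[OF \<mu> coer] that by blast+

  define k1 where "k1 = real CARD('n) * (ln c + real (2 * CARD('n)) * ln d) - ln (fact CARD('n))"
  define k2 where "k2 = real CARD('n) * real (2 * CARD('n))"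
  have ln_det: "k1 - k2 * ln (lam\<^sup>2 + d) \<le> ln (det (A lam))" if lam: "lam > 0" for lam
  proof -
    have ld: "lam\<^sup>2 + d > 0" using d by (simp add: add_nonneg_pos)
    have "ln (\<mu> lam ^ CARD('n) / fact CARD('n)) \<le> ln (det (A lam))"
      using coercive_det_ge[OF \<mu>[OF lam] coer[OF lam]] \<mu>[OF lam] det_pos[OF lam] by simp
    also have "ln (\<mu> lam ^ CARD('n) / fact CARD('n)) = real CARD('n) * ln (\<mu> lam) - ln (fact CARD('n))"
      using \<mu>[OF lam] by (simp add: ln_div ln_realpow)
    also have "ln (\<mu> lam) = ln c + real (2 * CARD('n)) * (ln d - ln (lam\<^sup>2 + d))"
      unfolding \<mu>_def using c d ld by (simp add: ln_mult ln_realpow ln_div)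
    finally show ?thesis by (simp add: k1_def k2_def algebra_simps)
  qed
  have quad_nonneg: "0 \<le> v \<bullet> (A lam *v v)" for lam v unfolding form by (rule nonneg)

  have ev: "eventually (\<lambda>lam::real. lam > 0) at_top" by (rule eventually_gt_at_top)
  show ?thesis
  proof (intro conjI impI)
    assume "m_constant m x Y"
    then obtain y where W: "W = (\<chi> i. y)" by (auto simp: m_constant_def W_def)
    have upper: "likelihood_loss \<Phi> m x Y lam \<le> y\<^sup>2 * M + ln (det (A lam))" if "lam > 0" for lam
      unfolding loss W using inverse_form_le[OF inv[OF that] const M] by simp
    have "\<not> CARD('n) \<le> Suc 0" using assms(1) by simp
    then obtain i j :: 'n where ij: "i \<noteq> j"
      by (auto simp: card_le_Suc0_iff_eq)
    \<comment> \<open>All entries tend to \<open>\<Phi> 0\<close>, and the limiting matrix has two identical rows.\<close>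
    have entry: "((\<lambda>lam. A lam $ i $ j) \<longlongrightarrow> \<Phi> 0) at_top" for i j
    proof -
      have "((\<lambda>lam. (x i - x j) /\<^sub>R lam) \<longlongrightarrow> 0 *\<^sub>R (x i - x j)) at_top"
        by (intro tendsto_scaleR tendsto_const tendsto_inverse_0_at_top filterlim_ident)
      moreover have "isCont \<Phi> 0" using cont by (simp add: continuous_on_eq_continuous_at)
      ultimately show ?thesis
        unfolding A_def kernel_matrix_def scaled_kernel_def
        by (auto intro: isCont_tendsto_compose[of 0 \<Phi>])
    qed
    have "((\<lambda>lam. det (A lam)) \<longlongrightarrow> det ((\<chi> i j. \<Phi> 0) :: real ^ 'n ^ 'n)) at_top"
      unfolding det_def by (intro tendsto_sum tendsto_mult tendsto_const tendsto_prod) (simp add: entry)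
    also have "det ((\<chi> i j. \<Phi> 0) :: real ^ 'n ^ 'n) = 0"
      using ij by (intro det_identical_rows[of i j]) (simp_all add: row_def)
    finally have "filterlim (\<lambda>lam. det (A lam)) (at_right 0) at_top"
      by (rule tendsto_imp_filterlim_at_right[OF _ eventually_mono[OF ev det_pos]])
    hence "filterlim (\<lambda>lam. ln (det (A lam))) at_bot at_top"
      by (rule filterlim_compose[OF ln_at_0])
    hence "filterlim (\<lambda>lam. y\<^sup>2 * M + ln (det (A lam))) at_bot at_top"
      by (simp add: filterlim_tendsto_add_at_bot_iff[OF tendsto_const])
    thus lim: "filterlim (likelihood_loss \<Phi> m x Y) at_bot at_top"
      by (rule filterlim_at_bot_mono) (rule eventually_mono[OF ev upper])
    show "argmin_infinite (likelihood_loss \<Phi> m x Y)"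
    proof (rule argmin_infiniteI[OF lim])
      fix L
      have "k1 - k2 * ln (L\<^sup>2 + d) \<le> likelihood_loss \<Phi> m x Y lam" if lam: "0 < lam" "lam \<le> L" for lam
      proof -
        have "ln (lam\<^sup>2 + d) \<le> ln (L\<^sup>2 + d)"
          using lam d by (simp add: add_nonneg_pos power_mono)
        hence "k1 - k2 * ln (L\<^sup>2 + d) \<le> k1 - k2 * ln (lam\<^sup>2 + d)"
          by (simp add: k2_def mult_left_mono)
        also have "\<dots> \<le> ln (det (A lam))" using lam by (intro ln_det)
        also have "\<dots> \<le> likelihood_loss \<Phi> m x Y lam"
          using quad_nonneg[of "matrix_inv (A lam) *v W" lam]
          by (simp add: loss matrix_vector_mul_assoc inner_commute[of W]
              invertible_matrix_inv_right[OF inv[OF lam(1)]])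
        finally show ?thesis .
      qed
      thus "\<exists>b. \<forall>lam. 0 < lam \<longrightarrow> lam \<le> L \<longrightarrow> b \<le> likelihood_loss \<Phi> m x Y lam" by blast
    qed
  next
    assume nc: "\<not> m_constant m x Y"
    \<comment> \<open>Centring \<open>W\<close> gives a test vector with zero sum that is not orthogonal to \<open>W\<close>.\<close>
    define a where "a = W - (\<chi> i. (\<Sum>j\<in>UNIV. W $ j) / real CARD('n))"
    have "a \<noteq> 0" using nc by (auto simp: m_constant_def W_def[symmetric] a_def)
    hence aa: "a \<bullet> a > 0" by simp
    have a0: "(\<Sum>i\<in>UNIV. a $ i) = 0" by (simp add: a_def sum_subtractf)
    have "a \<bullet> (\<chi> i. y) = 0" for y
      using a0 by (simp add: inner_vec_def sum_distrib_right[symmetric])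
    from this[of "(\<Sum>j\<in>UNIV. W $ j) / real CARD('n)"] have aW: "a \<bullet> W = a \<bullet> a"
      by (simp add: a_def inner_diff_right)
    \<comment> \<open>Any exponent strictly between \<open>0\<close> and \<open>\<alpha> - d / 2\<close> that is at most \<open>1\<close> would do.\<close>
    define g where "g = min 1 ((\<alpha> - real CARD('d) / 2) / 2)"
    have g: "0 < g" "0 \<le> g" "g \<le> 1" "g < \<alpha> - real DIM(real ^ 'd) / 2"
      using assms(9) by (auto simp: g_def min_def)
    obtain M2 where M2: "M2 > 0" and decay: "\<And>(z :: 'n \<Rightarrow> real ^ 'd) v. (\<Sum>i\<in>UNIV. v i) = 0 \<Longrightarrow>
        kernel_form \<Phi> UNIV z v \<le> M2 * (\<Sum>i\<in>UNIV. \<bar>v i\<bar> * norm (z i) powr g)\<^sup>2"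
      using kernel_form_le_of_sum_zero[OF int cont B assms(8) g(2-4) upper, where 'i='n]
      by (meson finite)
    define S where "S = (\<Sum>i\<in>UNIV. \<bar>a $ i\<bar> * norm (x i) powr g)"
    \<comment> \<open>The summand \<open>1\<close> makes \<open>M3\<close> positive even if \<open>S\<close> vanishes.\<close>
    define M3 where "M3 = M2 * S\<^sup>2 + 1"
    have M3: "M3 > 0" using M2 by (simp add: M3_def add_nonneg_pos)
    define e where "e = (a \<bullet> a)\<^sup>2 / M3"
    have e: "e > 0" using aa M3 by (simp add: e_def)
    have "e * lam powr (2 * g) + (k1 - k2 * ln (lam\<^sup>2 + d)) \<le> likelihood_loss \<Phi> m x Y lam"
      if lam: "lam > 0" for lam
    proof -
      have sym: "transpose (A lam) = A lam"
        using even[of "(x i - x j) /\<^sub>R lam" for i j]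
        by (simp add: transpose_def A_def kernel_matrix_def scaled_kernel_def vec_eq_iff
            flip: scaleR_minus_right)
      have "0 < \<mu> lam * (a \<bullet> a)" using \<mu>[OF lam] aa by simp
      also have "\<dots> \<le> a \<bullet> (A lam *v a)" by (rule coer[OF lam])
      finally have pos: "a \<bullet> (A lam *v a) > 0" .
      have "a \<bullet> (A lam *v a) \<le> M2 * (\<Sum>i\<in>UNIV. \<bar>a $ i\<bar> * norm (x i /\<^sub>R lam) powr g)\<^sup>2"
        unfolding form using a0 by (rule decay)
      also have "(\<Sum>i\<in>UNIV. \<bar>a $ i\<bar> * norm (x i /\<^sub>R lam) powr g) = S * lam powr (- g)"
        using lam by (simp add: S_def sum_distrib_left powr_mult powr_minus inverse_powr mult_ac)
      also have "M2 * (S * lam powr (- g))\<^sup>2 = M2 * S\<^sup>2 * lam powr (- (2 * g))"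
        by (simp add: power_mult_distrib power2_eq_square[of "_ powr _"] powr_add[symmetric])
      also have "\<dots> \<le> M3 * lam powr (- (2 * g))"
        unfolding M3_def by (intro mult_right_mono) auto
      finally have Q: "a \<bullet> (A lam *v a) \<le> M3 * lam powr (- (2 * g))" .
      have "e * lam powr (2 * g) = (a \<bullet> W)\<^sup>2 / (M3 * lam powr (- (2 * g)))"
        by (simp add: e_def aW powr_minus_divide)
      also have "\<dots> \<le> (a \<bullet> W)\<^sup>2 / (a \<bullet> (A lam *v a))"
        using pos Q by (intro divide_left_mono) auto
      also have "\<dots> \<le> W \<bullet> (matrix_inv (A lam) *v W)"
        by (rule inverse_form_ge[OF inv[OF lam] sym quad_nonneg pos])
      finally show ?thesis using ln_det[OF lam] by (simp add: loss)
    qed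
    note ge = this
    have "filterlim (\<lambda>lam. e * lam powr (2 * g) + (k1 - k2 * ln (lam\<^sup>2 + d))) at_top at_top"
      using e g(1) d by real_asymp
    thus "filterlim (likelihood_loss \<Phi> m x Y) at_top at_top"
      by (rule filterlim_at_top_mono) (rule eventually_mono[OF ev ge])
    thus "argmin_finite (likelihood_loss \<Phi> m x Y)" by (rule argmin_finiteI)
  qed
qed

end
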